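(* Let $(X,\rho)$ be a metric space and let $(P_t)_{t\ge 0}$ be a stochastically continuous Feller Markov semigroup on $B_b(X)$ with dual semigroup $(P_t^{\ast})_{t\ge 0}$ on $\mathcal{M}_1(X)$. Assume that there exist $z\in X$ and a probability measure $\mu\in\mathcal{M}_1(X)$ such that for every $\varepsilon>0$ $$\liminf_{t\to\infty}\frac1t\int_0^t P_s^{\ast}\mu(B(z,\varepsilon))\,ds>0.$$ If the family $(P_t\varphi)_{t\ge 0}$ is equicontinuous at $z$ for every $\varphi\in C_b(X)$, then the semigroup $(P_t)_{t\ge0}$ has an invariant probability measure, i.e. there is $\mu_{\ast}\in\mathcal{M}_1(X)$ with $P_t^{\ast}\mu_{\ast}=\mu_{\ast}$ for all $t\ge0$.
   Context: $(X,\rho)$ is an arbitrary metric space (not assumed separable or complete). $B(x,r)$ is the open ball with centre $x$ and radius $r$; $B_b(X)$ is the space of real bounded Borel measurable functions on $X$ with the supremum norm; $C_b(X)$ is its subspace of bounded continuous functions; $\mathcal{M}_1(X)$ is the set of (countably additive) Borel probability measures on $X$; $\langle\varphi,\mu\rangle=\int_X\varphi\,d\mu$. A Markov semigroup $(P_t)_{t\ge0}$ on $B_b(X)$ is a semigroup of linear operators on $B_b(X)$ with $P_t\mathbf 1_X=\mathbf 1_X$ and $P_t\varphi\ge0$ whenever $\varphi\ge0$. It is called Feller if $P_t(C_b(X))\subset C_b(X)$ for all $t\geq 0$ and there is a semigroup $P_t^{\ast}:\mathcal{M}_1(X)\to\mathcal{M}_1(X)$, $t\ge0$, dual to $(P_t)$: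 $\langle P_t\varphi,\mu\rangle=\langle\varphi,P_t^{\ast}\mu\rangle$ for all $\varphi\in B_b(X)$, $\mu\in\mathcal{M}_1(X)$, $t\ge0$. It is stochastically continuous if $\lim_{t\to0^+}P_t\psi(x)=\psi(x)$ for all $\psi\in C_b(X)$, $x\in X$. The family $(P_t\varphi)_{t\ge0}$ is equicontinuous at $x$ if $\lim_{y\to x}\sup_{t\ge0}|P_t\varphi(y)-P_t\varphi(x)|=0$. *)

theory Defs
  imports "HOL-Probability.Probability"
begin

definition Bb :: "('a::metric_space \<Rightarrow> real) set" where
  "Bb = {\<phi>. \<phi> \<in> borel_measurable borel \<and> bounded (range \<phi>)}"

definition Cb :: "('a::metric_space \<Rightarrow> real) set" where
  "Cb = {\<phi>. continuous_on UNIV \<phi> \<and> bounded (range \<phi>)}"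

definition M1 :: "('a::metric_space) measure set" where
  "M1 = {\<mu>. sets \<mu> = sets borel \<and> prob_space \<mu>}"

(* Operators on Bb and on M1 are represented by total functions indexed by the reals;
   only their values on Bb (resp. M1) for times t >= 0 are constrained or used.
   A semigroup of operators is understood to have the identity at time 0. *)

definition markov_semigroup ::
  "(real \<Rightarrow> ('a::metric_space \<Rightarrow> real) \<Rightarrow> ('a \<Rightarrow> real)) \<Rightarrow> bool" where
  "markov_semigroup P \<longleftrightarrow>
     (\<forall>t\<ge>0. \<forall>\<phi>\<in>Bb. P t \<phi> \<in> Bb) \<and>
     (\<forall>t\<ge>0. \<forall>\<phi>\<in>Bb. \<forall>\<psi>\<in>Bb. \<forall>a b. P t (\<lambda>x. a * \<phi> x + b * \<psi> x) = (\<lambda>x. a * P t \<phi> x + b * P t \<psi> x)) \<and>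
     (\<forall>\<phi>\<in>Bb. P 0 \<phi> = \<phi>) \<and>
     (\<forall>s\<ge>0. \<forall>t\<ge>0. \<forall>\<phi>\<in>Bb. P (s + t) \<phi> = P s (P t \<phi>)) \<and>
     (\<forall>t\<ge>0. P t (\<lambda>x. 1) = (\<lambda>x. 1)) \<and>
     (\<forall>t\<ge>0. \<forall>\<phi>\<in>Bb. (\<forall>x. \<phi> x \<ge> 0) \<longrightarrow> (\<forall>x. P t \<phi> x \<ge> 0))"

definition dual_semigroup ::
  "(real \<Rightarrow> ('a::metric_space \<Rightarrow> real) \<Rightarrow> ('a \<Rightarrow> real)) \<Rightarrow>
   (real \<Rightarrow> 'a measure \<Rightarrow> 'a measure) \<Rightarrow> bool" where
  "dual_semigroup P Pd \<longleftrightarrow>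
     (\<forall>t\<ge>0. \<forall>\<mu>\<in>M1. Pd t \<mu> \<in> M1) \<and>
     (\<forall>\<mu>\<in>M1. Pd 0 \<mu> = \<mu>) \<and>
     (\<forall>s\<ge>0. \<forall>t\<ge>0. \<forall>\<mu>\<in>M1. Pd (s + t) \<mu> = Pd s (Pd t \<mu>)) \<and>
     (\<forall>t\<ge>0. \<forall>\<phi>\<in>Bb. \<forall>\<mu>\<in>M1. (\<integral>x. P t \<phi> x \<partial>\<mu>) = (\<integral>x. \<phi> x \<partial>(Pd t \<mu>)))"

definition feller ::
  "(real \<Rightarrow> ('a::metric_space \<Rightarrow> real) \<Rightarrow> ('a \<Rightarrow> real)) \<Rightarrow> bool" where
  "feller P \<longleftrightarrow> (\<forall>t\<ge>0. P t ` Cb \<subseteq> Cb) \<and> (\<exists>Pd. dual_semigroup P Pd)"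

definition stochastically_continuous ::
  "(real \<Rightarrow> ('a::metric_space \<Rightarrow> real) \<Rightarrow> ('a \<Rightarrow> real)) \<Rightarrow> bool" where
  "stochastically_continuous P \<longleftrightarrow>
     (\<forall>\<psi>\<in>Cb. \<forall>x. ((\<lambda>t. P t \<psi> x) \<longlongrightarrow> \<psi> x) (at_right 0))"

(* The supremum is taken in the conditionally complete lattice of reals; for a Markov
   semigroup and bounded \<phi> it is over a set bounded by 2 * sup |\<phi>|. *)
definition equicontinuous_at ::
  "(real \<Rightarrow> ('a::metric_space \<Rightarrow> real) \<Rightarrow> ('a \<Rightarrow> real)) \<Rightarrow> ('a \<Rightarrow> real) \<Rightarrow> 'a \<Rightarrow> bool" where
  "equicontinuous_at P \<phi> x \<longleftrightarrow>
     ((\<lambda>y. SUP t\<in>{0..}. \<bar>P t \<phi> y - P t \<phi> x\<bar>) \<longlongrightarrow> 0) (at x)"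

definition invariant_probability ::
  "(real \<Rightarrow> ('a::metric_space) measure \<Rightarrow> 'a measure) \<Rightarrow> 'a measure \<Rightarrow> bool" where
  "invariant_probability Pd \<mu> \<longleftrightarrow> \<mu> \<in> M1 \<and> (\<forall>t\<ge>0. Pd t \<mu> = \<mu>)"

end

theory Submission
  imports Defs
begin

text \<open>
  If bounded continuous functions \<open>\<phi> n\<close> decrease pointwise to 0, then \<open>P t (\<phi> n) z\<close> tends to 0
  uniformly in \<open>t\<close>. Otherwise, along a subsequence, the increments \<open>f n = \<phi> n - \<phi> (Suc n)\<close> have
  \<open>P (t n) (f n) z\<close> bounded away from 0. The lower bound on the time averages of \<open>\<mu>\<close> forbids the
  same near \<open>z\<close>, because the \<open>f n\<close> have a bounded sum; a gliding hump then produces a function in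
  \<^term>\<open>Cb\<close> whose orbit is not equicontinuous at \<open>z\<close>.
  Hence any cluster point, in the product topology, of the time averages of \<open>\<lambda>f. P t f z\<close> is an
  invariant positive functional which is continuous along such sequences. By Daniell's construction
  it is integration against a Borel probability measure, which is invariant.
\<close>

section \<open>Cluster points and time integrals\<close>

text \<open>By Tychonoff the product of the closures \<open>K i\<close> is compact, so the sequence
  has a cluster point in the product topology. A filter replaces a subsequence because the index
  type may be uncountable, and all coordinates must converge together.\<close>

lemma bounded_family_cluster:
  fixes a :: "nat \<Rightarrow> 'i \<Rightarrow> real"
  assumes "\<And>i. bounded (range (\<lambda>n. a n i))"
  obtains F L where "F \<noteq> bot" "F \<le> sequentially" "\<And>i. ((\<lambda>n. a n i) \<longlongrightarrow> L i) F"
proof -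
  define K where "K i = closure (range (\<lambda>n. a n i))" for i
  have "compact (PiE UNIV K)"
    using assms compactin_PiE[of "\<lambda>i. euclidean" UNIV K]
    by (simp add: euclidean_product_topology K_def compact_closure)
  moreover have "eventually (\<lambda>x. x \<in> PiE UNIV K) (filtermap a sequentially)"
    unfolding eventually_filtermap K_def by (intro always_eventually) (auto simp: PiE_def closure_subset[THEN subsetD])
  ultimately obtain L where L: "inf (nhds L) (filtermap a sequentially) \<noteq> bot"
    unfolding compact_filter by (metis filtermap_bot_iff trivial_limit_sequentially)
  \<comment> \<open>Neighbourhoods of \<open>L\<close> are pulled back along \<open>a\<close> and
    met with \<open>sequentially\<close>; this filter is proper exactly because \<open>L\<close> is
    a cluster point.\<close>
  define F where "F = inf (filtercomap a (nhds L)) sequentially"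
  have "F \<noteq> bot"
  proof
    assume "F = bot"
    then have "eventually (\<lambda>_. False) F" by simp
    then obtain Q R where QR: "eventually Q (filtercomap a (nhds L))" "eventually R sequentially"
      "\<And>x. Q x \<Longrightarrow> R x \<Longrightarrow> False"
      unfolding F_def eventually_inf by auto
    then obtain Q' where Q': "eventually Q' (nhds L)" "\<And>n. Q' (a n) \<Longrightarrow> Q n"
      unfolding eventually_filtercomap by auto
    have "eventually (\<lambda>x. \<not> Q' x) (filtermap a sequentially)"
      unfolding eventually_filtermap using QR(2) by eventually_elim (use QR(3) Q'(2) in blast)
    with Q'(1) have "eventually (\<lambda>_. False) (inf (nhds L) (filtermap a sequentially))"
      unfolding eventually_inf by blast
    with L show False by (simp add: eventually_False)
  qed
  moreover have "F \<le> sequentially" by (simp add: F_def)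
  moreover have "((\<lambda>n. a n i) \<longlongrightarrow> L i) F" for i
  proof -
    have "filterlim a (nhds L) F"
      unfolding filterlim_def F_def by (meson filtermap_filtercomap filtermap_mono inf_le1 order_trans)
    then show ?thesis
      by (rule continuous_on_tendsto_compose[OF continuous_on_product_coordinates]) auto
  qed
  ultimately show thesis using that by blast
qed

text \<open>\<open>F\<close> is the pointwise limit of step functions that sample it at the next
  grid point to the right, for grids of mesh \<open>1 / Suc n\<close>.\<close>

lemma borel_measurable_right_continuous:
  fixes F :: "real \<Rightarrow> real"
  assumes "\<And>s. (F \<longlongrightarrow> F s) (at_right s)"
  shows "F \<in> borel_measurable borel"
proof -
  \<comment> \<open>Floor plus one, unlike a ceiling, keeps \<open>u n s\<close> strictly above
    \<open>s\<close>, so that it converges within \<open>at_right s\<close>.\<close>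
  define u :: "nat \<Rightarrow> real \<Rightarrow> real" where "u n s = (real_of_int \<lfloor>s * real (Suc n)\<rfloor> + 1) / real (Suc n)" for n s
  have gt: "u n s > s" and le: "u n s \<le> s + 1 / real (Suc n)" for n s
  proof -
    have "s * real (Suc n) < real_of_int \<lfloor>s * real (Suc n)\<rfloor> + 1"
      "real_of_int \<lfloor>s * real (Suc n)\<rfloor> \<le> s * real (Suc n)" by linarith+
    then show "u n s > s" "u n s \<le> s + 1 / real (Suc n)"
      unfolding u_def by (simp_all add: field_simps del: of_nat_Suc)
  qed
  have "(\<lambda>n. u n s) \<longlonglongrightarrow> s" for s
  proof (rule tendsto_sandwich[where f="\<lambda>n. s"])
    show "(\<lambda>n. s + 1 / real (Suc n)) \<longlonglongrightarrow> s"
      using tendsto_add[OF tendsto_const LIMSEQ_inverse_real_of_nat, of s] by (simp add: inverse_eq_divide)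
  qed (use gt le in \<open>auto intro!: always_eventually less_imp_le simp del: of_nat_Suc\<close>)
  then have "filterlim (\<lambda>n. u n s) (at_right s) sequentially" for s
    using gt by (auto simp: filterlim_at less_imp_neq[THEN not_sym])
  then have "(\<lambda>n. F (u n s)) \<longlonglongrightarrow> F s" for s
    using assms filterlim_compose by blast
  moreover have "(\<lambda>s. F (u n s)) \<in> borel_measurable borel" for n
  proof -
    \<comment> \<open>The sampled function factors through the integer floor, and every function on
      the discrete integers is measurable.\<close>
    have "(\<lambda>i::int. F ((real_of_int i + 1) / real (Suc n))) \<circ> (\<lambda>s. \<lfloor>s * real (Suc n)\<rfloor>) \<in> borel_measurable borel"
      by (rule measurable_comp[of _ _ "count_space UNIV"]) auto
    then show ?thesis by (simp add: u_def comp_def)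
  qed
  ultimately show ?thesis by (rule borel_measurable_LIMSEQ_real[where u="\<lambda>n s. F (u n s)"])
qed

lemma set_integrable_bounded_interval:
  fixes F :: "real \<Rightarrow> real"
  assumes [measurable]: "F \<in> borel_measurable borel" and "\<And>s. \<bar>F s\<bar> \<le> C"
  shows "set_integrable lborel {a..b} F"
proof -
  have "integrable lborel (\<lambda>s. C * indicator {a..b} s)"
    by (intro integrable_mult_right integrable_real_indicator) (auto simp: emeasure_lborel_Icc_eq)
  then show ?thesis unfolding set_integrable_def
    by (rule Bochner_Integration.integrable_bound) (use assms(2) in \<open>auto simp: indicator_def intro!: AE_I2 intro: order_trans[OF _ abs_ge_self]\<close>)
qed

lemma set_integral_abs_le_interval:
  fixes F :: "real \<Rightarrow> real"
  assumes "F \<in> borel_measurable borel" and "\<And>s. \<bar>F s\<bar> \<le> C" "a \<le> b"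
  shows "\<bar>LBINT s:{a..b}. F s\<bar> \<le> C * (b - a)"
proof -
  note I = set_integrable_bounded_interval[OF assms(1,2)]
  have J: "set_integrable lborel {a..b} (\<lambda>s. C)" for C :: real
    by (rule set_integrable_bounded_interval[where C="\<bar>C\<bar>"]) auto
  have "(LBINT s:{a..b}. F s) \<le> (LBINT s:{a..b}. C)" "(LBINT s:{a..b}. -C) \<le> (LBINT s:{a..b}. F s)"
    by (intro set_integral_mono I J; use assms(2) in \<open>simp add: abs_le_iff minus_le_iff\<close>)+
  then show ?thesis using assms(3) by (simp add: set_integral_const abs_le_iff mult.commute)
qed

text \<open>The windows \<open>{r..t+r}\<close> and \<open>{0..t}\<close> differ by two end
  intervals of length \<open>r\<close>. The bound is independent of \<open>t\<close>, so it vanishes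
  after division by \<open>t\<close>.\<close>

lemma set_integral_shift_le:
  fixes F :: "real \<Rightarrow> real"
  assumes [measurable]: "F \<in> borel_measurable borel" and C: "\<And>s. \<bar>F s\<bar> \<le> C"
    and "0 \<le> r" "0 \<le> t"
  shows "\<bar>(LBINT s:{0..t}. F (s + r)) - (LBINT s:{0..t}. F s)\<bar> \<le> 2 * C * r"
proof -
  note I = set_integrable_bounded_interval[OF assms(1,2)]
  have split: "(LBINT s:{0..x+y}. F s) = (LBINT s:{0..x}. F s) + (LBINT s:{x..x+y}. F s)"
    if "0 \<le> x" "0 \<le> y" for x y
  proof -
    have "{0..x+y} = {0..x} \<union> {x..x+y}" using that by auto
    then show ?thesis
      using AE_lborel_singleton[of x] by (simp only:, intro set_integral_Un_AE I) auto
  qed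
  have "(LBINT s:{r..t+r}. F s) = (LBINT s:{0..t}. F (s + r))"
    unfolding set_lebesgue_integral_def
    by (subst lborel_integral_real_affine[where c=1 and t=r])
       (auto intro!: Bochner_Integration.integral_cong simp: indicator_def add.commute)
  moreover have "(LBINT s:{0..t+r}. F s) = (LBINT s:{0..r}. F s) + (LBINT s:{r..t+r}. F s)"
    using split[of r t] assms by (simp add: add.commute)
  moreover have "(LBINT s:{0..t+r}. F s) = (LBINT s:{0..t}. F s) + (LBINT s:{t..t+r}. F s)"
    using split[of t r] assms by simp
  ultimately show ?thesis 
    using set_integral_abs_le_interval[OF assms(1,2) \<open>0 \<le> r\<close>] set_integral_abs_le_interval[OF assms(1,2), of t "t+r"] assms
    by (simp add: abs_le_iff)
qed

section \<open>Bounded continuous functions and Borel probability measures\<close>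

lemma CbI: "continuous_on UNIV f \<Longrightarrow> (\<And>x. \<bar>f x\<bar> \<le> C) \<Longrightarrow> f \<in> Cb"
  unfolding Cb_def by (auto intro!: boundedI[where B=C])

lemma Cb_continuous: "f \<in> Cb \<Longrightarrow> continuous_on UNIV f"
  by (simp add: Cb_def)

lemma Cb_bounded: assumes "f \<in> Cb" obtains C where "\<And>x. \<bar>f x\<bar> \<le> C"
  using assms unfolding Cb_def bounded_iff by auto

lemma Bb_bounded: assumes "f \<in> Bb" obtains C where "\<And>x. \<bar>f x\<bar> \<le> C"
  using assms unfolding Bb_def bounded_iff by auto

lemma Cb_subset_Bb: "f \<in> Cb \<Longrightarrow> f \<in> Bb"
  unfolding Cb_def Bb_def by (auto intro: borel_measurable_continuous_onI)

lemma Cb_const [simp]: "(\<lambda>x. c) \<in> Cb"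
  by (rule CbI[where C="\<bar>c\<bar>"]) auto

lemma Cb_add: assumes "f \<in> Cb" "g \<in> Cb" shows "(\<lambda>x. f x + g x) \<in> Cb"
proof -
  obtain C D where "\<And>x. \<bar>f x\<bar> \<le> C" "\<And>x. \<bar>g x\<bar> \<le> D" using assms Cb_bounded by metis
  then have "\<bar>f x + g x\<bar> \<le> C + D" for x by (intro order_trans[OF abs_triangle_ineq] add_mono)
  moreover have "continuous_on UNIV (\<lambda>x. f x + g x)"
    using assms by (intro continuous_intros Cb_continuous)
  ultimately show ?thesis by (intro CbI)
qed

lemma Cb_mult: assumes "f \<in> Cb" "g \<in> Cb" shows "(\<lambda>x. f x * g x) \<in> Cb"
proof -
  obtain C D where "\<And>x. \<bar>f x\<bar> \<le> C" "\<And>x. \<bar>g x\<bar> \<le> D" using assms Cb_bounded by metis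
  then have "\<bar>f x * g x\<bar> \<le> C * D" for x
    unfolding abs_mult by (intro mult_mono) (auto intro: order_trans[OF abs_ge_zero])
  moreover have "continuous_on UNIV (\<lambda>x. f x * g x)"
    using assms by (intro continuous_intros Cb_continuous)
  ultimately show ?thesis by (intro CbI)
qed

lemma Cb_diff: "f \<in> Cb \<Longrightarrow> g \<in> Cb \<Longrightarrow> (\<lambda>x. f x - g x) \<in> Cb"
  using Cb_add[of f "\<lambda>x. (-1) * g x"] Cb_mult[of "\<lambda>_. -1" g] by simp

lemma Cb_min: assumes "f \<in> Cb" "g \<in> Cb" shows "(\<lambda>x. min (f x) (g x)) \<in> Cb"
proof -
  obtain C D where "\<And>x. \<bar>f x\<bar> \<le> C" "\<And>x. \<bar>g x\<bar> \<le> D" using assms Cb_bounded by metis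
  then have "\<bar>min (f x) (g x)\<bar> \<le> max C D" for x
    by (simp add: min_def max.coboundedI1 max.coboundedI2)
  moreover have "continuous_on UNIV (\<lambda>x. min (f x) (g x))"
    using assms by (intro continuous_intros Cb_continuous)
  ultimately show ?thesis by (intro CbI)
qed

lemma Cb_sum: "(\<And>i. i \<in> I \<Longrightarrow> f i \<in> Cb) \<Longrightarrow> (\<lambda>x. \<Sum>i\<in>I. f i x) \<in> Cb"
  by (induction I rule: infinite_finite_induct) (simp_all add: Cb_add)

lemmas Cb_intros = Cb_const Cb_add Cb_mult Cb_diff Cb_min Cb_sum

section \<open>Integration against Borel probability measures\<close>

lemma M1_prob_space: "m \<in> M1 \<Longrightarrow> prob_space m"
  by (simp add: M1_def)

lemma M1_sets: "m \<in> M1 \<Longrightarrow> sets m = sets borel"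
  by (simp add: M1_def)

lemma M1_integrable: assumes "m \<in> M1" "f \<in> Bb" shows "integrable m f"
proof -
  interpret prob_space m using assms(1) by (rule M1_prob_space)
  obtain C where "\<And>x. \<bar>f x\<bar> \<le> C" using Bb_bounded[OF assms(2)] by blast
  moreover have "f \<in> borel_measurable m"
    using assms by (simp add: Bb_def M1_sets measurable_cong_sets[OF M1_sets refl])
  ultimately show ?thesis by (intro integrable_const_bound[where B=C]) auto
qed

lemma M1_measure_space [simp]: "m \<in> M1 \<Longrightarrow> measure m (space m) = 1"
  by (simp add: M1_prob_space prob_space.prob_space)

lemma M1_integrable_const [simp]: "m \<in> M1 \<Longrightarrow> integrable m (\<lambda>x. c::real)"
  by (intro M1_integrable Cb_subset_Bb Cb_const)

lemma M1_measurable_iff: "m \<in> M1 \<Longrightarrow> f \<in> borel_measurable m \<longleftrightarrow> f \<in> borel_measurable borel"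
  by (simp add: measurable_cong_sets[OF M1_sets refl])

lemma Cb_open_approx:
  fixes U :: "'a::metric_space set"
  assumes "open U"
  obtains h where "h \<in> Cb" "\<And>x. 0 \<le> h x" "\<And>x. h x \<le> 1" "U = {x. h x > 0}"
proof (cases "U = UNIV")
  case True
  then show ?thesis by (intro that[of "\<lambda>x. 1"]) auto
next
  case False
  \<comment> \<open>The whole space was split off because \<open>infdist\<close> to the empty set is
    0 by convention.\<close>
  define h where "h x = min 1 (infdist x (-U))" for x
  have h: "continuous_on UNIV h" unfolding h_def by (intro continuous_intros)
  show ?thesis
  proof (rule that)
    show "h \<in> Cb" by (rule CbI[where C=1, OF h]) (auto simp: h_def infdist_nonneg)
    show "U = {x. h x > 0}"
    proof -
      have "x \<in> - U \<longleftrightarrow> infdist x (-U) = 0" for x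
        using False assms by (intro in_closed_iff_infdist_zero) (auto simp: closed_Compl)
      then have "h x > 0 \<longleftrightarrow> x \<in> U" for x
        using infdist_nonneg[of x "-U"] unfolding h_def by (metis ComplI ComplD less_le min_less_iff_conj zero_less_one)
      then show ?thesis by blast
    qed
  qed (auto simp: h_def infdist_nonneg)
qed

text \<open>Open sets form an intersection-stable generator of the Borel sets, and the indicator of
  an open set is the increasing limit of the continuous functions
  \<open>min 1 (k * h)\<close>.\<close>

lemma M1_eqI:
  fixes m n :: "'a::metric_space measure"
  assumes m: "m \<in> M1" and n: "n \<in> M1"
    and eq: "\<And>f. f \<in> Cb \<Longrightarrow> (\<integral>x. f x \<partial>m) = (\<integral>x. f x \<partial>n)"
  shows "m = n"
proof (rule measure_eqI_generator_eq[where E="Collect open" and \<Omega>=UNIV and A="\<lambda>_. UNIV"])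
  interpret m: prob_space m using m by (rule M1_prob_space)
  interpret n: prob_space n using n by (rule M1_prob_space)
  show "sets m = sigma_sets UNIV (Collect open)" "sets n = sigma_sets UNIV (Collect open)"
    using m n by (simp_all add: M1_sets borel_def)
  show "emeasure m UNIV \<noteq> \<infinity>" using m.emeasure_finite by simp
  fix U :: "'a set" assume "U \<in> Collect open"
  then obtain h where h: "h \<in> Cb" "\<And>x. 0 \<le> h x" "\<And>x. h x \<le> 1" "U = {x. h x > 0}"
    using Cb_open_approx by blast
  have lim: "(\<lambda>k. \<integral>x. min 1 (real k * h x) \<partial>l) \<longlonglongrightarrow> measure l U" if l: "l \<in> M1" for l
  proof -
    interpret prob_space l using l by (rule M1_prob_space)
    have [measurable]: "h \<in> borel_measurable l"
      using Cb_subset_Bb[OF h(1)] by (simp add: M1_measurable_iff[OF l] Bb_def)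
    have "U \<in> sets l" using \<open>U \<in> _\<close> l by (simp add: M1_sets)
    have "(\<lambda>k. \<integral>x. min 1 (real k * h x) \<partial>l) \<longlonglongrightarrow> (\<integral>x. indicator U x \<partial>l)"
    proof (rule integral_dominated_convergence[where w="\<lambda>x. 1"])
      show "AE x in l. (\<lambda>k. min 1 (real k * h x)) \<longlonglongrightarrow> indicator U x"
      proof (rule AE_I2)
        fix x
        show "(\<lambda>k. min 1 (real k * h x)) \<longlonglongrightarrow> indicator U x"
        proof (cases "x \<in> U")
          case True
          then obtain k where k: "real k * h x > 1" using h(4) reals_Archimedean3 by blast
          have "eventually (\<lambda>n. min 1 (real n * h x) = 1) sequentially"
            using eventually_ge_at_top[of k]
          proof eventually_elim
            case (elim n)
            then have "real k * h x \<le> real n * h x" using h(2) by (intro mult_right_mono) auto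
            with k show ?case by auto
          qed
          with True show ?thesis by (simp add: tendsto_eventually)
        next
          case False
          then have "h x = 0" using h(2)[of x] h(4) by auto
          with False show ?thesis by simp
        qed
      qed
    qed (use h(2) \<open>U \<in> sets l\<close> in \<open>auto intro!: AE_I2\<close>)
    then show ?thesis using \<open>U \<in> sets l\<close> by simp
  qed
  have "(\<lambda>x. min 1 (real k * h x)) \<in> Cb" for k by (intro Cb_intros h)
  with eq have "(\<lambda>k. \<integral>x. min 1 (real k * h x) \<partial>m) = (\<lambda>k. \<integral>x. min 1 (real k * h x) \<partial>n)" by blast
  then have "measure m U = measure n U" using lim[OF m] lim[OF n] LIMSEQ_unique by metis
  then show "emeasure m U = emeasure n U" by (simp add: m.emeasure_eq_measure n.emeasure_eq_measure)
qed (auto simp: Int_stable_def)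

section \<open>Daniell functionals\<close>

text \<open>On a noncompact space a positive normalised functional on \<open>Cb\<close> need not
  come from a countably additive measure; \<open>monotone\<close>, Daniell's condition, supplies
  what is missing.\<close>

locale daniell_functional =
  fixes L :: "('a::metric_space \<Rightarrow> real) \<Rightarrow> real"
  assumes add: "f \<in> Cb \<Longrightarrow> g \<in> Cb \<Longrightarrow> L (\<lambda>x. f x + g x) = L f + L g"
    and scale: "f \<in> Cb \<Longrightarrow> L (\<lambda>x. c * f x) = c * L f"
    and pos: "f \<in> Cb \<Longrightarrow> (\<And>x. 0 \<le> f x) \<Longrightarrow> 0 \<le> L f"
    and one: "L (\<lambda>x. 1) = 1"
    and monotone: "(\<And>n. \<phi> n \<in> Cb) \<Longrightarrow> (\<And>x. decseq (\<lambda>n. \<phi> n x)) \<Longrightarrow>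
      (\<And>x. (\<lambda>n. \<phi> n x) \<longlonglongrightarrow> 0) \<Longrightarrow> (\<lambda>n::nat. L (\<phi> n)) \<longlonglongrightarrow> 0"
begin

lemma const: "L (\<lambda>x. c) = c"
  using scale[of "\<lambda>x. 1" c] by (simp add: one)

lemma diff: "f \<in> Cb \<Longrightarrow> g \<in> Cb \<Longrightarrow> L (\<lambda>x. f x - g x) = L f - L g"
  using add[of f "\<lambda>x. (-1) * g x"] scale[of g "-1"] Cb_mult[of "\<lambda>_. -1" g] by simp

lemma mono: "f \<in> Cb \<Longrightarrow> g \<in> Cb \<Longrightarrow> (\<And>x. f x \<le> g x) \<Longrightarrow> L f \<le> L g"
  using pos[of "\<lambda>x. g x - f x"] diff[of g f] Cb_diff[of g f] by simp

lemma sum: "finite I \<Longrightarrow> (\<And>i. i \<in> I \<Longrightarrow> f i \<in> Cb) \<Longrightarrow> L (\<lambda>x. \<Sum>i\<in>I. f i x) = (\<Sum>i\<in>I. L (f i))"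
  by (induction I rule: finite_induct) (simp_all add: const add Cb_sum)

text \<open>The Daniell upper integral of indicator functions, over increasing sequences from \<^term>\<open>Cb\<close>.
  It needs no continuity of \<open>L\<close> to be an outer measure for which open sets are measurable;
  \<open>monotone\<close> only serves to see that the total mass is 1.\<close>
definition cover :: "(nat \<Rightarrow> 'a \<Rightarrow> real) \<Rightarrow> 'a set \<Rightarrow> bool" where
  "cover f A \<longleftrightarrow> (\<forall>n. f n \<in> Cb) \<and> (\<forall>n x. 0 \<le> f n x) \<and> (\<forall>x. incseq (\<lambda>n. f n x)) \<and> (\<forall>x\<in>A. \<exists>n. 1 \<le> f n x)"

lemma coverD:
  assumes "cover f A"
  shows "f n \<in> Cb" "0 \<le> f n x" "m \<le> n \<Longrightarrow> f m x \<le> f n x" "x \<in> A \<Longrightarrow> \<exists>n. 1 \<le> f n x"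
  using assms by (auto simp: cover_def incseq_def)

lemma coverI:
  assumes "\<And>n. f n \<in> Cb" "\<And>n x. 0 \<le> f n x" "\<And>n x. f n x \<le> f (Suc n) x" "\<And>x. x \<in> A \<Longrightarrow> \<exists>n. 1 \<le> f n x"
  shows "cover f A"
  using assms by (auto simp: cover_def intro: incseq_SucI)

definition cover_value :: "(nat \<Rightarrow> 'a \<Rightarrow> real) \<Rightarrow> ennreal" where
  "cover_value f = (SUP n. ennreal (L (f n)))"

definition outer :: "'a set \<Rightarrow> ennreal" where
  "outer A = (INF f\<in>{f. cover f A}. cover_value f)"

section \<open>The outer measure induced by the functional\<close>

lemma outer_le: "cover f A \<Longrightarrow> outer A \<le> cover_value f"
  unfolding outer_def by (auto intro: INF_lower)

lemma outer_le_L: 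
  assumes "f \<in> Cb" "\<And>x. 0 \<le> f x" "\<And>x. x \<in> A \<Longrightarrow> 1 \<le> f x"
  shows "outer A \<le> ennreal (L f)"
proof -
  have "cover (\<lambda>n. f) A" using assms by (intro coverI) auto
  from outer_le[OF this] show ?thesis by (simp add: cover_value_def)
qed

lemma outer_le_1: "outer A \<le> 1"
  using outer_le_L[of "\<lambda>x. 1" A] by (simp add: one)

lemma outer_mono: "A \<subseteq> B \<Longrightarrow> outer A \<le> outer B"
  unfolding outer_def by (intro INF_superset_mono) (auto simp: cover_def)

lemma outer_empty: "outer {} = 0"
  using outer_le_L[of "\<lambda>x. 0" "{}"] by (simp add: const)

text \<open>Near-optimal covers of the \<open>A k\<close>, with errors \<open>e / 2 ^ Suc k\<close>
  that sum to \<open>e\<close>, are added up to a cover of the union.\<close>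

lemma outer_UN_le: "outer (\<Union>i. A i) \<le> (\<Sum>i. outer (A i))"
proof (rule ennreal_le_epsilon)
  fix e :: real assume e: "0 < e"
  have "\<exists>f. cover f (A k) \<and> cover_value f < outer (A k) + ennreal (e * (1/2) ^ Suc k)" for k
  proof -
    have "outer (A k) < outer (A k) + ennreal (e * (1/2) ^ Suc k)"
      using e outer_le_1[of "A k"] by (auto simp: ennreal_add_left_cancel_less[of _ 0, simplified] top_unique)
    then show ?thesis by (subst (asm) (1) outer_def) (auto simp: INF_less_iff)
  qed
  then obtain f where f: "\<And>k. cover (f k) (A k)" "\<And>k. cover_value (f k) < outer (A k) + ennreal (e * (1/2) ^ Suc k)"
    by metis
  note fD = coverD[OF f(1)]
  \<comment> \<open>Diagonal sums: \<open>n\<close> bounds both the number of covers and their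
    stage, so \<open>g n\<close> is a finite sum in \<open>Cb\<close> and still increases with
    \<open>n\<close>.\<close>
  define g where "g n x = (\<Sum>k\<le>n. f k n x)" for n x
  have "cover g (\<Union>i. A i)"
  proof (rule coverI)
    fix n x
    show "g n \<in> Cb" unfolding g_def by (intro Cb_intros fD)
    show "0 \<le> g n x" unfolding g_def by (intro sum_nonneg fD)
    have "g n x \<le> (\<Sum>k\<le>n. f k (Suc n) x)" unfolding g_def by (intro sum_mono fD) simp
    also have "\<dots> \<le> g (Suc n) x" unfolding g_def using fD(2) by simp
    finally show "g n x \<le> g (Suc n) x" .
  next
    fix x assume "x \<in> (\<Union>i. A i)"
    then obtain k n where "1 \<le> f k n x" using fD(4) by blast
    also have "f k n x \<le> f k (max k n) x" by (intro fD) simp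
    also have "\<dots> \<le> g (max k n) x" unfolding g_def by (rule member_le_sum) (auto intro: fD)
    finally show "\<exists>n. 1 \<le> g n x" by blast
  qed
  then have "outer (\<Union>i. A i) \<le> cover_value g" by (rule outer_le)
  also have "\<dots> \<le> (\<Sum>k. cover_value (f k))"
    unfolding cover_value_def[of g]
  proof (rule SUP_least)
    fix n
    have "ennreal (L (g n)) = (\<Sum>k\<le>n. ennreal (L (f k n)))"
      unfolding g_def by (subst sum) (auto simp: fD pos sum_ennreal)
    also have "\<dots> \<le> (\<Sum>k\<le>n. cover_value (f k))" unfolding cover_value_def by (intro sum_mono SUP_upper) simp
    also have "\<dots> \<le> (\<Sum>k. cover_value (f k))" by (intro sum_le_suminf) auto
    finally show "ennreal (L (g n)) \<le> (\<Sum>k. cover_value (f k))" .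
  qed
  also have "\<dots> \<le> (\<Sum>k. outer (A k) + ennreal (e * (1/2) ^ Suc k))"
    by (intro suminf_le less_imp_le f) auto
  also have "\<dots> = (\<Sum>k. outer (A k)) + (\<Sum>k. ennreal (e * (1/2) ^ Suc k))"
    by (intro suminf_add[symmetric]) auto
  also have "(\<Sum>k. ennreal (e * (1/2) ^ Suc k)) = ennreal e"
    using e sums_mult[OF power_half_series, of e] by (intro suminf_ennreal_eq) auto
  finally show "outer (\<Union>i. A i) \<le> (\<Sum>i. outer (A i)) + ennreal e" .
qed

lemma outer_measure_space: "outer_measure_space (Pow UNIV) outer"
  unfolding outer_measure_space_def positive_def increasing_def countably_subadditive_def
  by (auto simp: outer_empty outer_mono outer_UN_le)

text \<open>The functions \<open>u n\<close> increase to the indicator of \<open>U\<close>.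
  Multiplying a cover of \<open>A\<close> by \<open>u n\<close> and by \<open>1 - u n\<close> splits
  it into covers of \<open>A \<inter> U\<close> and \<open>A - U\<close>.\<close>

lemma outer_open_split:
  assumes "open U"
  shows "outer (A \<inter> U) + outer (A - U) \<le> outer A"
  unfolding outer_def[of A]
proof (rule INF_greatest, clarify)
  fix f assume f: "cover f A"
  note fD = coverD[OF f]
  from assms obtain h where h: "h \<in> Cb" "\<And>x. 0 \<le> h x" "U = {x. h x > 0}"
    using Cb_open_approx by blast
  define u where "u n x = min 1 (real n * h x)" for n x
  have u: "u n \<in> Cb" "0 \<le> u n x" "u n x \<le> 1" for n x
    unfolding u_def using h(2) by (intro Cb_intros h(1), simp_all)
  have fu: "(\<lambda>x. f m x * u n x) \<in> Cb" "(\<lambda>x. f m x * (1 - u n x)) \<in> Cb" for m n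
    by (intro Cb_intros fD u)+
  have "cover (\<lambda>n x. f n x * u n x) (A \<inter> U)"
  proof (rule coverI)
    fix n x
    have "real n * h x \<le> real (Suc n) * h x" using h(2) by (intro mult_right_mono) auto
    then have "u n x \<le> u (Suc n) x" unfolding u_def by simp
    then show "f n x * u n x \<le> f (Suc n) x * u (Suc n) x" by (intro mult_mono fD u) auto
  next
    fix x assume x: "x \<in> A \<inter> U"
    then obtain n where n: "1 \<le> f n x" using fD(4) by blast
    obtain k where k: "1 < real k * h x" using x h(3) reals_Archimedean3 by blast
    have "real k * h x \<le> real (max n k) * h x" using h(2) by (intro mult_right_mono) auto
    with k have "u (max n k) x = 1" unfolding u_def by simp
    moreover have "1 \<le> f (max n k) x" using n fD(3)[of n "max n k" x] by simp
    ultimately show "\<exists>n. 1 \<le> f n x * u n x" by (intro exI[of _ "max n k"]) simp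
  qed (use fu fD u in auto)
  from outer_le[OF this] have 1: "outer (A \<inter> U) \<le> (SUP n. ennreal (L (\<lambda>x. f n x * u n x)))"
    by (simp add: cover_value_def)
  \<comment> \<open>Here \<open>n\<close> stays fixed: \<open>1 - u n\<close> decreases in
    \<open>n\<close>, so the diagonal sequence could fail to increase.\<close>
  have 2: "outer (A - U) \<le> (SUP m. ennreal (L (\<lambda>x. f m x * (1 - u n x))))" for n
  proof -
    have "cover (\<lambda>m x. f m x * (1 - u n x)) (A - U)"
    proof (rule coverI)
      fix x assume x: "x \<in> A - U"
      then have "u n x = 0" using h(2)[of x] h(3) by (auto simp: u_def)
      with x fD(4) show "\<exists>m. 1 \<le> f m x * (1 - u n x)" by auto
    qed (use fu fD u in \<open>auto intro!: mult_right_mono\<close>)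
    from outer_le[OF this] show ?thesis by (simp add: cover_value_def)
  qed
  \<comment> \<open>Raising both stages to \<open>max n m\<close> lets the weights
    \<open>u n\<close> and \<open>1 - u n\<close> recombine to 1.\<close>
  have 3: "ennreal (L (\<lambda>x. f n x * u n x)) + ennreal (L (\<lambda>x. f m x * (1 - u n x))) \<le> cover_value f" for n m
  proof -
    define M where "M = max n m"
    have "L (\<lambda>x. f n x * u n x) + L (\<lambda>x. f m x * (1 - u n x))
        \<le> L (\<lambda>x. f M x * u n x) + L (\<lambda>x. f M x * (1 - u n x))"
      by (intro add_mono mono fu mult_right_mono fD) (auto simp: M_def u)
    also have "\<dots> = L (f M)" by (subst add[OF fu, symmetric]) (simp add: algebra_simps)
    finally have "ennreal (L (\<lambda>x. f n x * u n x)) + ennreal (L (\<lambda>x. f m x * (1 - u n x))) \<le> ennreal (L (f M))"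
      by (subst ennreal_plus[symmetric]) (auto intro!: pos fu mult_nonneg_nonneg fD u ennreal_leI simp: u(3))
    also have "\<dots> \<le> cover_value f" unfolding cover_value_def by (intro SUP_upper) simp
    finally show ?thesis .
  qed
  \<comment> \<open>The two suprema are pulled out one after the other, first over the diagonal
    index \<open>n\<close>, then over \<open>m\<close> with \<open>n\<close> fixed.\<close>
  have "outer (A \<inter> U) + outer (A - U) \<le> (SUP n. ennreal (L (\<lambda>x. f n x * u n x)) + outer (A - U))"
    using 1 by (subst ennreal_SUP_add_left) (auto intro: add_right_mono)
  also have "\<dots> \<le> cover_value f"
  proof (rule SUP_least)
    fix n
    have "ennreal (L (\<lambda>x. f n x * u n x)) + outer (A - U)
      \<le> (SUP m. ennreal (L (\<lambda>x. f n x * u n x)) + ennreal (L (\<lambda>x. f m x * (1 - u n x))))"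
      using 2[of n] by (subst ennreal_SUP_add_right[symmetric]) (auto intro: add_left_mono)
    also have "\<dots> \<le> cover_value f" by (intro SUP_least 3)
    finally show "ennreal (L (\<lambda>x. f n x * u n x)) + outer (A - U) \<le> cover_value f" .
  qed
  finally show "outer (A \<inter> U) + outer (A - U) \<le> cover_value f" .
qed

text \<open>A cover of the whole space, truncated at height 1, is eventually equal to 1 at each
  point. Its distance from 1 therefore decreases to 0 and \<open>monotone\<close> applies.\<close>

lemma outer_UNIV: "outer UNIV = 1"
proof (rule antisym[OF outer_le_1])
  show "1 \<le> outer UNIV"
    unfolding outer_def
  proof (rule INF_greatest, clarify)
    fix f assume f: "cover f UNIV"
    note fD = coverD[OF f]
    have Cb: "(\<lambda>x. min 1 (f n x)) \<in> Cb" for n by (intro Cb_intros fD)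
    have "(\<lambda>n. L (\<lambda>x. 1 - min 1 (f n x))) \<longlonglongrightarrow> 0"
    proof (rule monotone)
      fix x
      show "decseq (\<lambda>n. 1 - min 1 (f n x))" by (auto simp: decseq_def intro: fD min.coboundedI2)
      obtain k where k: "1 \<le> f k x" using fD(4) by blast
      have "eventually (\<lambda>n. 1 - min 1 (f n x) = 0) sequentially"
        using eventually_ge_at_top[of k] by eventually_elim (use k fD(3) order_trans in fastforce)
      then show "(\<lambda>n. 1 - min 1 (f n x)) \<longlonglongrightarrow> 0" by (rule tendsto_eventually)
    qed (intro Cb_intros Cb)
    then have "(\<lambda>n. 1 - (1 - L (\<lambda>x. min 1 (f n x)))) \<longlonglongrightarrow> 1 - 0"
      by (intro tendsto_diff tendsto_const) (simp add: diff[OF Cb_const Cb] const)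
    then have "(\<lambda>n. L (\<lambda>x. min 1 (f n x))) \<longlonglongrightarrow> 1" by simp
    then have "(\<lambda>n. ennreal (L (\<lambda>x. min 1 (f n x)))) \<longlonglongrightarrow> ennreal 1" by (rule tendsto_ennrealI)
    moreover have "ennreal (L (\<lambda>x. min 1 (f n x))) \<le> cover_value f" for n
      unfolding cover_value_def by (rule SUP_upper2[of n]) (auto intro!: ennreal_leI mono Cb fD)
    ultimately show "1 \<le> cover_value f" by (metis LIMSEQ_le_const2 ennreal_1)
  qed
qed

text \<open>Caratheodory's theorem makes \<open>outer\<close> a measure on \<open>S\<close>, which
  contains the open and hence the Borel sets. Integrals are compared with \<open>L\<close> first for
  functions with values in [0,1], then for all of \<open>Cb\<close> by an affine change of
  values.\<close>

lemma representation: "\<exists>m\<in>M1. \<forall>f\<in>Cb. (\<integral>x. f x \<partial>m) = L f"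
proof -
  define S where "S = lambda_system UNIV (Pow UNIV) outer"
  interpret Pow: sigma_algebra UNIV "Pow UNIV :: 'a set set" by (rule sigma_algebra_Pow)
  have meas: "measure_space UNIV S outer"
    unfolding S_def using Pow.caratheodory_lemma[OF outer_measure_space] .
  have "U \<in> S" if U: "open U" for U
  proof -
    have "outer (U \<inter> A) + outer (A - U) = outer A" for A
    proof (rule antisym)
      have "subadditive (Pow UNIV) outer"
        using outer_measure_space Pow.countably_subadditive_subadditive by (auto simp: outer_measure_space_def)
      then have "outer ((U \<inter> A) \<union> (A - U)) \<le> outer (U \<inter> A) + outer (A - U)"
        by (rule subadditiveD) auto
      moreover have "(U \<inter> A) \<union> (A - U) = A" by auto
      ultimately show "outer A \<le> outer (U \<inter> A) + outer (A - U)" by simp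
    qed (use outer_open_split[OF U, of A] in \<open>simp add: Int_commute\<close>)
    moreover have "(UNIV - U) \<inter> A = A - U" for A by auto
    ultimately show ?thesis by (simp add: S_def lambda_system_def)
  qed
  then have S: "sigma_sets UNIV (Collect open) \<subseteq> S"
    using meas by (intro sigma_algebra.sigma_sets_subset) (auto simp: measure_space_def)
  define m where "m = measure_of UNIV (Collect open) outer"
  have sets: "sets m = sigma_sets UNIV (Collect open)" by (simp add: m_def)
  have em: "emeasure m A = outer A" if "A \<in> sets borel" for A
  proof (rule emeasure_measure_of[OF m_def])
    show "countably_additive (sets m) outer"
      using meas S by (auto simp: measure_space_def countably_additive_def sets subset_eq)
    show "positive (sets m) outer" by (simp add: positive_def outer_empty)
    show "A \<in> sets m" using that by (simp add: sets borel_def)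
  qed auto
  have m: "m \<in> M1"
    unfolding M1_def
  proof (intro CollectI conjI prob_spaceI)
    show "sets m = sets borel" by (simp add: sets borel_def)
    show "emeasure m (space m) = 1" using em[of UNIV] by (simp add: m_def outer_UNIV)
  qed
  interpret prob_space m using m by (rule M1_prob_space)
  have int: "f \<in> Cb \<Longrightarrow> integrable m f" for f using M1_integrable[OF m Cb_subset_Bb] .
  txt \<open>Slicing \<open>f\<close> at the levels \<open>k / N\<close> gives this inequality; applied also to \<open>1 - f\<close> it
    gives equality.\<close>
  have le: "(\<integral>x. f x \<partial>m) \<le> L f" if f: "f \<in> Cb" "\<And>x. 0 \<le> f x" "\<And>x. f x \<le> 1" for f
  proof (rule field_le_epsilon)
    fix e :: real assume "0 < e"
    then obtain n where n: "1 / real (Suc n) < e" using nat_approx_posE by blast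
    define N where "N = Suc n"
    \<comment> \<open>\<open>g k\<close> is the layer of \<open>N * f\<close> between heights
      \<open>k\<close> and \<open>k + 1\<close>; it equals 1 on \<open>A k\<close>, so
      \<open>L (g k)\<close> bounds the outer measure of \<open>A k\<close>.\<close>
    define g where "g k x = min (real N * f x) (real (Suc k)) - min (real N * f x) (real k)" for k x
    define A where "A k = {x. real (Suc k) \<le> real N * f x}" for k
    have g: "g k \<in> Cb" for k unfolding g_def by (intro Cb_intros f)
    have A: "A k \<in> sets borel" for k
      unfolding A_def using Cb_continuous[OF f(1)] 
      by (intro borel_closed closed_Collect_le continuous_intros) auto
    have "emeasure m (A k) \<le> ennreal (L (g k))" for k
      unfolding em[OF A] by (intro outer_le_L g) (auto simp: g_def A_def)
    then have Lg: "measure m (A k) \<le> L (g k)" for k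
      unfolding emeasure_eq_measure by (subst (asm) ennreal_le_iff) (auto intro!: pos g simp: g_def)
    have sumg: "(\<Sum>k<M. g k x) = min (real N * f x) (real M)" for M x
      using f(2)[of x] by (induction M) (auto simp: g_def)
    \<comment> \<open>Counting the integer levels below \<open>y\<close> loses at most 1, which
      becomes the error \<open>1 / N\<close> after division by \<open>N\<close>.\<close>
    have count: "min y (real M) \<le> 1 + (\<Sum>k<M. of_bool (real (Suc k) \<le> y))" if "0 \<le> y" for y and M :: nat
    proof (induction M)
      case (Suc M)
      show ?case
      proof (cases "y \<le> real M \<or> y \<ge> real (Suc M)")
        case True
        with Suc show ?thesis by (auto simp: min_def split: if_splits)
      next
        case False
        then have "(\<Sum>k<M. of_bool (real (Suc k) \<le> y)) = (\<Sum>k<M. 1::real)"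
          by (intro sum.cong) auto
        with False show ?thesis by simp
      qed
    qed (use that in simp)
    have "real N * f x \<le> 1 + (\<Sum>k<N. indicator (A k) x)" for x
      using count[of "real N * f x" N] f(2)[of x] mult_left_mono[OF f(3)[of x], of "real N"]
      by (simp add: A_def indicator_def del: of_nat_Suc sum_of_bool_eq)
    then have "(\<integral>x. real N * f x \<partial>m) \<le> (\<integral>x. 1 + (\<Sum>k<N. indicator (A k) x) \<partial>m)"
      using A by (intro integral_mono int Cb_intros f Bochner_Integration.integrable_add
          Bochner_Integration.integrable_sum integrable_real_indicator)
        (auto simp: M1_sets[OF m] emeasure_eq_measure)
    also have "\<dots> = 1 + (\<Sum>k<N. measure m (A k))"
      using A by (subst Bochner_Integration.integral_add)
        (auto simp: M1_sets[OF m] emeasure_eq_measure prob_space less_top[symmetric])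
    also have "\<dots> \<le> 1 + (\<Sum>k<N. L (g k))" by (intro add_left_mono sum_mono Lg)
    also have "(\<Sum>k<N. L (g k)) = L (\<lambda>x. real N * f x)"
    proof -
      have "(\<lambda>x. \<Sum>k<N. g k x) = (\<lambda>x. real N * f x)"
        using mult_left_mono[OF f(3), of "real N"] by (auto simp: sumg min_def fun_eq_iff)
      then show ?thesis using sum[of "{..<N}" g] g by simp
    qed
    also have "\<dots> = real N * L f" by (rule scale[OF f(1)])
    finally have "real N * (\<integral>x. f x \<partial>m) \<le> 1 + real N * L f" by simp
    then have "(\<integral>x. f x \<partial>m) \<le> L f + 1 / real N" by (simp add: N_def field_simps del: of_nat_Suc)
    with n show "(\<integral>x. f x \<partial>m) \<le> L f + e" by (simp add: N_def)
  qed
  have eq: "(\<integral>x. f x \<partial>m) = L f" if f: "f \<in> Cb" "\<And>x. 0 \<le> f x" "\<And>x. f x \<le> 1" for f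
    using le[OF f] le[of "\<lambda>x. 1 - f x"] f int[OF f(1)]
    by (simp add: Cb_intros diff const prob_space)
  have "(\<integral>x. f x \<partial>m) = L f" if f: "f \<in> Cb" for f
  proof -
    obtain C where C: "\<And>x. \<bar>f x\<bar> \<le> C" using f Cb_bounded by blast
    \<comment> \<open>Adding 1 makes \<open>D\<close> positive even for \<open>f = 0\<close>, so
      \<open>g\<close> may divide by it.\<close>
    define D where "D = C + 1"
    have D: "\<bar>f x\<bar> < D" "D > 0" for x using C[of x] by (auto simp: D_def)
    define g where "g x = 1 / (2 * D) * (f x + D)" for x
    have g: "g \<in> Cb" unfolding g_def by (intro Cb_intros f)
    have fg: "f = (\<lambda>x. 2 * D * g x - D)" using D(2) by (auto simp: g_def fun_eq_iff field_simps)
    have "(\<integral>x. g x \<partial>m) = L g"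
    proof (intro eq g)
      fix x
      show "0 \<le> g x" "g x \<le> 1" using D(1)[of x] D(2) by (simp_all add: g_def field_simps)
    qed
    moreover have "L f = 2 * D * L g - D"
      unfolding fg by (subst diff) (auto intro!: Cb_intros g simp: scale[OF g] const)
    moreover have "(\<integral>x. f x \<partial>m) = 2 * D * (\<integral>x. g x \<partial>m) - D"
      unfolding fg using int[OF g] by (simp add: prob_space)
    ultimately show ?thesis by simp
  qed
  with m show ?thesis by blast
qed

end

section \<open>Orbits of Feller semigroups\<close>

text \<open>An e/3 argument in which the continuous error bound \<open>\<psi> k\<close> replaces
  uniform convergence: once small at \<open>x\<close>, it stays small nearby.\<close>

lemma continuous_on_sandwich:
  fixes S :: "'a::topological_space \<Rightarrow> real"
  assumes H: "\<And>k. continuous_on UNIV (H k)" and \<psi>: "\<And>k. continuous_on UNIV (\<psi> k)"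
    and S: "\<And>k x. H k x \<le> S x" "\<And>k x. S x \<le> H k x + \<psi> k x"
    and lim: "\<And>x. (\<lambda>k::nat. \<psi> k x) \<longlonglongrightarrow> 0"
  shows "continuous_on UNIV S"
  unfolding continuous_on_def
proof (intro ballI tendstoI)
  fix x and e :: real assume e: "0 < e"
  obtain k where k: "\<psi> k x < e / 3"
    using eventually_happens[OF order_tendstoD(2)[OF lim, of "e/3" x]] e by auto
  have cont: "(\<psi> k \<longlongrightarrow> \<psi> k x) (at x)" "(H k \<longlongrightarrow> H k x) (at x)"
    using H \<psi> by (simp_all add: continuous_on_def)
  have "\<forall>\<^sub>F y in at x. \<psi> k y < e / 3" by (rule order_tendstoD(2)[OF cont(1) k])
  moreover have "\<forall>\<^sub>F y in at x. dist (H k y) (H k x) < e / 3"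
    using e by (intro tendstoD[OF cont(2)]) simp
  ultimately show "\<forall>\<^sub>F y in at x within UNIV. dist (S y) (S x) < e"
  proof eventually_elim
    case (elim y)
    with k S(1)[of k y] S(2)[of y k] S(1)[of k x] S(2)[of x k] show ?case
      unfolding dist_real_def by linarith
  qed
qed

locale feller_markov =
  fixes P :: "real \<Rightarrow> ('a::metric_space \<Rightarrow> real) \<Rightarrow> ('a \<Rightarrow> real)"
    and Pd :: "real \<Rightarrow> 'a measure \<Rightarrow> 'a measure"
  assumes markov: "markov_semigroup P"
    and feller: "feller P"
    and stochastically_continuous: "stochastically_continuous P"
    and dual: "dual_semigroup P Pd"
begin

section \<open>Transition kernels and elementary estimates\<close>

lemma P_Bb: "0 \<le> t \<Longrightarrow> f \<in> Bb \<Longrightarrow> P t f \<in> Bb"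
  using markov by (simp add: markov_semigroup_def)

lemma P_Cb: "0 \<le> t \<Longrightarrow> f \<in> Cb \<Longrightarrow> P t f \<in> Cb"
  using feller by (auto simp: feller_def)

lemma Pd_M1: "0 \<le> t \<Longrightarrow> \<nu> \<in> M1 \<Longrightarrow> Pd t \<nu> \<in> M1"
  using dual by (simp add: dual_semigroup_def)

lemma integral_Pd: "0 \<le> t \<Longrightarrow> f \<in> Bb \<Longrightarrow> \<nu> \<in> M1 \<Longrightarrow> (\<integral>x. f x \<partial>Pd t \<nu>) = (\<integral>x. P t f x \<partial>\<nu>)"
  using dual by (simp add: dual_semigroup_def)

lemma return_M1: "return borel x \<in> M1"
  by (simp add: M1_def prob_space_return)

text \<open>The measures \<open>Pd t (return borel x)\<close> are the transition kernel of the
  semigroup, so facts about integrals transfer to \<open>P t\<close>.\<close>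

lemma P_eq: "0 \<le> t \<Longrightarrow> f \<in> Bb \<Longrightarrow> P t f x = (\<integral>y. f y \<partial>Pd t (return borel x))"
  using P_Bb[of t f] by (simp add: integral_Pd return_M1 integral_return Bb_def)

lemma integrable_Pd: "0 \<le> t \<Longrightarrow> f \<in> Cb \<Longrightarrow> \<nu> \<in> M1 \<Longrightarrow> integrable (Pd t \<nu>) f"
  by (intro M1_integrable Pd_M1 Cb_subset_Bb)

lemma P_mono: "0 \<le> t \<Longrightarrow> f \<in> Cb \<Longrightarrow> g \<in> Cb \<Longrightarrow> (\<And>x. f x \<le> g x) \<Longrightarrow> P t f x \<le> P t g x"
  by (simp add: P_eq Cb_subset_Bb integral_mono integrable_Pd return_M1)

lemma P_add: "0 \<le> t \<Longrightarrow> f \<in> Cb \<Longrightarrow> g \<in> Cb \<Longrightarrow> P t (\<lambda>x. f x + g x) x = P t f x + P t g x"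
  by (simp add: P_eq Cb_subset_Bb Cb_add integrable_Pd return_M1)

lemma P_diff: "0 \<le> t \<Longrightarrow> f \<in> Cb \<Longrightarrow> g \<in> Cb \<Longrightarrow> P t (\<lambda>x. f x - g x) x = P t f x - P t g x"
  by (simp add: P_eq Cb_subset_Bb Cb_diff integrable_Pd return_M1)

lemma P_const: "0 \<le> t \<Longrightarrow> P t (\<lambda>x. c) x = c"
  by (simp add: P_eq Cb_subset_Bb Pd_M1 return_M1)

lemma P_abs_le:
  assumes "0 \<le> t" "f \<in> Cb" "\<And>x. \<bar>f x\<bar> \<le> C"
  shows "\<bar>P t f x\<bar> \<le> C"
proof -
  have "- C \<le> f y" "f y \<le> C" for y using assms(3)[of y] by linarith+
  then show ?thesis
    using P_mono[OF assms(1,2) Cb_const, of C x] P_mono[OF assms(1) Cb_const assms(2), of "-C" x]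
    by (simp add: P_const[OF assms(1)] abs_le_iff)
qed

text \<open>Dominated convergence against the kernel. The time \<open>t\<close> is fixed here;
  uniformity in \<open>t\<close> at \<open>z\<close> is the content of
  \<open>uniformly_small\<close>.\<close>

lemma P_tendsto_0:
  assumes t: "0 \<le> t" and f: "\<And>n. f n \<in> Cb" "\<And>n x. \<bar>f n x\<bar> \<le> C" "\<And>x. (\<lambda>n. f n x) \<longlonglongrightarrow> 0"
  shows "(\<lambda>n. P t (f n) x) \<longlonglongrightarrow> 0"
proof -
  let ?k = "Pd t (return borel x)"
  have k: "?k \<in> M1" using t by (intro Pd_M1 return_M1)
  have "(\<lambda>n. \<integral>y. f n y \<partial>?k) \<longlonglongrightarrow> (\<integral>y. 0 \<partial>?k)"
    by (rule integral_dominated_convergence[where w="\<lambda>_. C"])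
      (use f k t in \<open>auto intro: M1_integrable Cb_subset_Bb borel_measurable_integrable\<close>)
  then show ?thesis using t f(1) by (simp add: P_eq Cb_subset_Bb)
qed

text \<open>The orbit differences are bounded by \<open>C + C\<close>, so the real supremum in the
  definition does dominate each of them. The case \<open>y = z\<close>, invisible to
  \<open>at z\<close>, is trivial.\<close>

lemma equicontinuous_atD:
  assumes "equicontinuous_at P f z" "f \<in> Cb" "0 < e"
  obtains d where "0 < d" "\<And>y t. dist y z < d \<Longrightarrow> 0 \<le> t \<Longrightarrow> \<bar>P t f y - P t f z\<bar> < e"
proof -
  let ?S = "\<lambda>y. SUP t\<in>{0..}. \<bar>P t f y - P t f z\<bar>"
  obtain C where C: "\<And>x. \<bar>f x\<bar> \<le> C" using assms(2) Cb_bounded by blast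
  have "\<bar>P t f y - P t f z\<bar> \<le> C + C" if "0 \<le> t" for y t
    using P_abs_le[OF that assms(2) C, of y] P_abs_le[OF that assms(2) C, of z] by linarith
  then have "bdd_above ((\<lambda>t. \<bar>P t f y - P t f z\<bar>) ` {0..})" for y
    by (intro bdd_aboveI[where M="C + C"]) auto
  then have le: "\<bar>P t f y - P t f z\<bar> \<le> ?S y" if "0 \<le> t" for t y
    using that by (intro cSUP_upper) auto
  have "eventually (\<lambda>y. ?S y < e) (at z)"
    using assms(1,3) unfolding equicontinuous_at_def by (rule order_tendstoD(2))
  then obtain d where d: "0 < d" "\<And>y. y \<noteq> z \<Longrightarrow> dist y z < d \<Longrightarrow> ?S y < e"
    unfolding eventually_at by auto
  have "\<bar>P t f y - P t f z\<bar> < e" if "dist y z < d" "0 \<le> t" for y t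
    using d(2)[OF _ that(1)] le[OF that(2), of y] assms(3) by (cases "y = z") auto
  with d(1) that show thesis by blast
qed

section \<open>Orbits of measures as functions of time\<close>

text \<open>Freezing negative times at 0 makes this function of time Borel measurable on the whole line.\<close>
definition orbit :: "'a measure \<Rightarrow> ('a \<Rightarrow> real) \<Rightarrow> real \<Rightarrow> real" where
  "orbit \<nu> f s = (\<integral>x. f x \<partial>Pd (max s 0) \<nu>)"

lemma orbit_shift:
  assumes "0 \<le> s" "0 \<le> r" "f \<in> Cb" "\<nu> \<in> M1"
  shows "orbit \<nu> f (s + r) = orbit \<nu> (P r f) s"
proof -
  have "Pd (r + s) \<nu> = Pd r (Pd s \<nu>)" using dual assms by (simp add: dual_semigroup_def)
  then show ?thesis
    using assms by (simp add: orbit_def add.commute integral_Pd Cb_subset_Bb Pd_M1)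
qed

lemma orbit_abs_le:
  assumes "f \<in> Cb" "\<And>x. \<bar>f x\<bar> \<le> C" "\<nu> \<in> M1"
  shows "\<bar>orbit \<nu> f s\<bar> \<le> C"
proof -
  let ?m = "Pd (max s 0) \<nu>"
  have m: "?m \<in> M1" using assms by (intro Pd_M1) auto
  have "- C \<le> f x" "f x \<le> C" for x using assms(2)[of x] by linarith+
  then have "(\<integral>x. - C \<partial>?m) \<le> (\<integral>x. f x \<partial>?m)" "(\<integral>x. f x \<partial>?m) \<le> (\<integral>x. C \<partial>?m)"
    using m assms(1) by (intro integral_mono M1_integrable Cb_subset_Bb; simp)+
  then show ?thesis using m by (simp add: orbit_def abs_le_iff)
qed

lemma orbit_mono:
  assumes "f \<in> Cb" "g \<in> Cb" "\<And>x. f x \<le> g x" "\<nu> \<in> M1"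
  shows "orbit \<nu> f s \<le> orbit \<nu> g s"
  unfolding orbit_def using assms by (intro integral_mono integrable_Pd) auto

lemma orbit_add: "f \<in> Cb \<Longrightarrow> g \<in> Cb \<Longrightarrow> \<nu> \<in> M1 \<Longrightarrow>
    orbit \<nu> (\<lambda>x. f x + g x) s = orbit \<nu> f s + orbit \<nu> g s"
  unfolding orbit_def by (intro Bochner_Integration.integral_add integrable_Pd) auto

lemma orbit_scale: "orbit \<nu> (\<lambda>x. c * f x) s = c * orbit \<nu> f s"
  unfolding orbit_def by simp

lemma orbit_sum: "(\<And>i. i \<in> I \<Longrightarrow> f i \<in> Cb) \<Longrightarrow> \<nu> \<in> M1 \<Longrightarrow>
    orbit \<nu> (\<lambda>x. \<Sum>i\<in>I. f i x) s = (\<Sum>i\<in>I. orbit \<nu> (f i) s)"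
  unfolding orbit_def by (intro Bochner_Integration.integral_sum integrable_Pd) auto

lemma orbit_return: "0 \<le> s \<Longrightarrow> f \<in> Cb \<Longrightarrow> orbit (return borel x) f s = P s f x"
  by (simp add: orbit_def P_eq Cb_subset_Bb)

text \<open>For \<open>r > s\<close> the value at \<open>r\<close> is the integral of
  \<open>P (r - s) f\<close> against \<open>Pd s \<nu>\<close>. Stochastic continuity at time 0 and
  dominated convergence, used along sequences, thus give right continuity.\<close>

lemma orbit_measurable:
  assumes f: "f \<in> Cb" and \<nu>: "\<nu> \<in> M1"
  shows "orbit \<nu> f \<in> borel_measurable borel"
proof (rule borel_measurable_right_continuous)
  fix s :: real
  obtain C where C: "\<And>x. \<bar>f x\<bar> \<le> C" using f Cb_bounded by blast
  show "(orbit \<nu> f \<longlongrightarrow> orbit \<nu> f s) (at_right s)"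
  proof (cases "s < 0")
    case True
    have "\<forall>\<^sub>F r in at_right s. orbit \<nu> f r = orbit \<nu> f s"
      using eventually_at_right_less[of s] eventually_at_right_real[OF True]
      by eventually_elim (use True in \<open>simp add: orbit_def max_def\<close>)
    then show ?thesis by (rule tendsto_eventually)
  next
    case False
    then have s: "0 \<le> s" by simp
    show ?thesis
    proof (rule tendsto_at_right_sequentially[of s "s + 1"])
      fix r assume r: "\<And>n. s < r n" "r \<longlonglongrightarrow> s"
      let ?m = "Pd s \<nu>"
      have m: "?m \<in> M1" using s \<nu> by (rule Pd_M1)
      have lim: "filterlim (\<lambda>n. r n - s) (at_right 0) sequentially"
        using r(1) tendsto_diff[OF r(2) tendsto_const[of s]]
        by (auto simp: filterlim_at less_imp_neq[THEN not_sym])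
      have "(\<lambda>n. \<integral>x. P (r n - s) f x \<partial>?m) \<longlonglongrightarrow> (\<integral>x. f x \<partial>?m)"
      proof (rule integral_dominated_convergence[where w="\<lambda>_. C"])
        have "((\<lambda>t. P t f x) \<longlongrightarrow> f x) (at_right 0)" for x
          using stochastically_continuous f by (simp add: stochastically_continuous_def)
        then have "(\<lambda>n. P (r n - s) f x) \<longlonglongrightarrow> f x" for x
          using lim by (rule filterlim_compose)
        then show "AE x in ?m. (\<lambda>n. P (r n - s) f x) \<longlonglongrightarrow> f x" by simp
        show "AE x in ?m. norm (P (r n - s) f x) \<le> C" for n
          using P_abs_le[OF _ f C] r(1)[of n] by simp
        show "(\<lambda>x. P (r n - s) f x) \<in> borel_measurable ?m" for n
          using m f r(1)[of n] by (intro borel_measurable_integrable M1_integrable P_Bb Cb_subset_Bb) auto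
        show "f \<in> borel_measurable ?m" "integrable ?m (\<lambda>_. C)"
          using m f by (auto intro!: borel_measurable_integrable M1_integrable Cb_subset_Bb)
      qed
      moreover have "orbit \<nu> f (r n) = (\<integral>x. P (r n - s) f x \<partial>?m)" for n
        using orbit_shift[OF s _ f \<nu>, of "r n - s"] r(1)[of n] s by (simp add: orbit_def)
      ultimately show "(\<lambda>n. orbit \<nu> f (r n)) \<longlonglongrightarrow> orbit \<nu> f s"
        using s by (simp add: orbit_def)
    qed simp
  qed
qed

lemma orbit_integrable:
  assumes "f \<in> Cb" "\<nu> \<in> M1"
  shows "set_integrable lborel {a..b} (orbit \<nu> f)"
proof -
  obtain C where "\<And>x. \<bar>f x\<bar> \<le> C" using assms Cb_bounded by blast
  with assms show ?thesis
    by (intro set_integrable_bounded_interval orbit_measurable orbit_abs_le)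
qed

end

section \<open>Lower bound and equicontinuity\<close>

locale feller_markov_lower_bound = feller_markov +
  fixes z :: 'a and \<mu> :: "'a measure"
  assumes \<mu>: "\<mu> \<in> M1"
    and lower_bound: "\<And>\<epsilon>::real. \<epsilon> > 0 \<Longrightarrow>
      Liminf at_top (\<lambda>t::real. ereal (1 / t * (LBINT s:{0..t}. measure (Pd s \<mu>) (ball z \<epsilon>)))) > 0"
    and equicontinuous: "\<And>\<phi>. \<phi> \<in> Cb \<Longrightarrow> equicontinuous_at P \<phi> z"
begin

lemma lower_boundE:
  assumes "0 < \<epsilon>"
  obtains c T where "0 < c" "0 < T"
    "\<And>t. T \<le> t \<Longrightarrow> c * t < (LBINT s:{0..t}. measure (Pd s \<mu>) (ball z \<epsilon>))"
proof -
  obtain c where c: "0 < ereal c"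
    "ereal c < Liminf at_top (\<lambda>t::real. ereal (1 / t * (LBINT s:{0..t}. measure (Pd s \<mu>) (ball z \<epsilon>))))"
    using ereal_dense2[OF lower_bound[OF assms]] by auto
  from less_LiminfD[OF c(2)] obtain T where
    T: "\<And>t. T \<le> t \<Longrightarrow> c < 1 / t * (LBINT s:{0..t}. measure (Pd s \<mu>) (ball z \<epsilon>))"
    by (auto simp: eventually_at_top_linorder)
  show thesis
  proof (rule that)
    \<comment> \<open>The maximum with 1 keeps \<open>t\<close> positive, so the factor
      \<open>1 / t\<close> can be cleared.\<close>
    fix t assume t: "max T 1 \<le> t"
    then show "c * t < (LBINT s:{0..t}. measure (Pd s \<mu>) (ball z \<epsilon>))"
      using T[of t] by (simp add: field_simps)
  qed (use c(1) in auto)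
qed

text \<open>Chebyshev's inequality for \<open>P r f\<close> under \<open>Pd s \<mu>\<close>, after
  the time \<open>r\<close> has been moved from the measure to the function.\<close>

lemma orbit_ball_bound:
  assumes "f \<in> Cb" "\<And>x. 0 \<le> f x" "0 \<le> r" "0 \<le> s"
    and e: "\<And>y. dist y z < d \<Longrightarrow> e \<le> P r f y"
  shows "e * measure (Pd s \<mu>) (ball z d) \<le> orbit \<mu> f (s + r)"
proof -
  let ?m = "Pd s \<mu>"
  have m: "?m \<in> M1" using assms(4) \<mu> by (rule Pd_M1)
  interpret prob_space ?m using m by (rule M1_prob_space)
  have "(\<integral>x. e * indicator (ball z d) x \<partial>?m) \<le> (\<integral>x. P r f x \<partial>?m)"
  proof (rule integral_mono)
    show "integrable ?m (\<lambda>x. e * indicator (ball z d) x)"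
      by (intro integrable_mult_right integrable_real_indicator) (auto simp: M1_sets[OF m] emeasure_eq_measure)
    show "integrable ?m (P r f)" using m assms by (intro M1_integrable Cb_subset_Bb P_Cb)
    fix x
    have "0 \<le> P r f x" using P_mono[OF assms(3) Cb_const assms(1), of 0 x] assms by (simp add: P_const)
    then show "e * indicator (ball z d) x \<le> P r f x"
      using e[of x] by (simp add: indicator_def dist_commute)
  qed
  then show ?thesis
    using assms \<mu> by (simp add: orbit_shift M1_sets[OF m]) (simp add: orbit_def)
qed

text \<open>Were \<open>e \<le> P (t n) (f n)\<close> on the whole ball for all large \<open>n\<close>, then each \<open>f n\<close> would have
  time average at least a fixed positive constant, although the \<open>f n\<close> sum to at most \<open>C\<close>.\<close>
lemma exists_small_value:
  fixes f :: "nat \<Rightarrow> 'a \<Rightarrow> real" and t :: "nat \<Rightarrow> real"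
  assumes f: "\<And>n. f n \<in> Cb" "\<And>n x. 0 \<le> f n x" and C: "\<And>I x. finite I \<Longrightarrow> (\<Sum>n\<in>I. f n x) \<le> C"
    and t: "\<And>n. 0 \<le> t n" and "0 < e" "0 < d"
  obtains y n where "dist y z < d" "N \<le> n" "P (t n) (f n) y < e"
proof (rule ccontr)
  assume "\<not> thesis"
  with that have e: "e \<le> P (t n) (f n) y" if "dist y z < d" "N \<le> n" for y n
    using \<open>dist y z < d\<close> \<open>N \<le> n\<close> by (meson not_le)
  let ?w = "\<lambda>s. measure (Pd s \<mu>) (ball z d)"
  obtain c T where c: "0 < c" "0 < T" and T: "\<And>\<tau>. T \<le> \<tau> \<Longrightarrow> c * \<tau> < (LBINT s:{0..\<tau>}. ?w s)"
    using lower_boundE[OF \<open>0 < d\<close>] by blast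
  \<comment> \<open>\<open>M\<close> functions, each with time average at least about
    \<open>e * c\<close>, together exceed the bound \<open>C\<close> of their sum.\<close>
  obtain M :: nat where M: "(C + 1) / (e * c) < real M" using reals_Archimedean2 by blast
  define J where "J = {N..<N + M}"
  have J: "finite J" "card J = M" "\<And>n. n \<in> J \<Longrightarrow> N \<le> n" by (auto simp: J_def)
  \<comment> \<open>\<open>K\<close> is the total cost of undoing the shifts by \<open>t n\<close>;
    it does not grow with the averaging length.\<close>
  define K where "K = (\<Sum>n\<in>J. 2 * C * t n)"
  have fC: "\<bar>f n x\<bar> \<le> C" for n x using C[of "{n}" x] f(2)[of n x] by simp
  have SJ: "(\<lambda>x. \<Sum>n\<in>J. f n x) \<in> Cb" "\<And>x. \<bar>\<Sum>n\<in>J. f n x\<bar> \<le> C"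
    using f C J(1) by (auto intro!: Cb_sum simp: sum_nonneg)
  have main: "real M * e * (c * \<tau>) \<le> C * \<tau> + K" if "T \<le> \<tau>" for \<tau>
  proof -
    have \<tau>: "0 < \<tau>" using c(2) that by simp
    \<comment> \<open>Integrability comes from the lower bound itself: a non-integrable function has
      Bochner integral 0 by default, which is not above \<open>c * \<tau>\<close>.\<close>
    have w: "set_integrable lborel {0..\<tau>} ?w"
    proof (rule ccontr)
      assume "\<not> set_integrable lborel {0..\<tau>} ?w"
      then have "(LBINT s:{0..\<tau>}. ?w s) = 0"
        unfolding set_integrable_def set_lebesgue_integral_def by (rule not_integrable_integral_eq)
      moreover have "0 < c * \<tau>" using c \<tau> by simp
      ultimately show False using T[OF that] by simp
    qed
    have each: "e * (c * \<tau>) \<le> (LBINT s:{0..\<tau>}. orbit \<mu> (f n) s) + 2 * C * t n" if n: "n \<in> J" for n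
    proof -
      have "e * (c * \<tau>) \<le> e * (LBINT s:{0..\<tau>}. ?w s)"
        using T[OF \<open>T \<le> \<tau>\<close>] \<open>0 < e\<close> by (intro mult_left_mono) auto
      also have "\<dots> = (LBINT s:{0..\<tau>}. e * ?w s)" by simp
      also have "\<dots> \<le> (LBINT s:{0..\<tau>}. orbit \<mu> (f n) (s + t n))"
      proof (rule set_integral_mono)
        show "set_integrable lborel {0..\<tau>} (\<lambda>s. orbit \<mu> (f n) (s + t n))"
          using orbit_measurable[OF f(1) \<mu>] orbit_abs_le[OF f(1) fC \<mu>]
          by (intro set_integrable_bounded_interval[where C=C]) auto
        show "e * ?w s \<le> orbit \<mu> (f n) (s + t n)" if "s \<in> {0..\<tau>}" for s
          using that J(3)[OF n] by (intro orbit_ball_bound f t e) auto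
      qed (use w in simp)
      also have "\<dots> \<le> (LBINT s:{0..\<tau>}. orbit \<mu> (f n) s) + 2 * C * t n"
        using set_integral_shift_le[OF orbit_measurable[OF f(1) \<mu>] orbit_abs_le[OF f(1) fC \<mu>], of "t n" \<tau> n] t[of n] \<tau>
        by (simp add: abs_le_iff)
      finally show ?thesis .
    qed
    have "real M * e * (c * \<tau>) = (\<Sum>n\<in>J. e * (c * \<tau>))" by (simp add: J)
    also have "\<dots> \<le> (\<Sum>n\<in>J. (LBINT s:{0..\<tau>}. orbit \<mu> (f n) s) + 2 * C * t n)"
      by (intro sum_mono each)
    also have "\<dots> = (\<Sum>n\<in>J. LBINT s:{0..\<tau>}. orbit \<mu> (f n) s) + K"
      by (simp add: sum.distrib K_def)
    also have "(\<Sum>n\<in>J. LBINT s:{0..\<tau>}. orbit \<mu> (f n) s) = (LBINT s:{0..\<tau>}. orbit \<mu> (\<lambda>x. \<Sum>n\<in>J. f n x) s)"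
      unfolding orbit_sum[OF f(1) \<mu>] set_lebesgue_integral_def scaleR_sum_right
      using orbit_integrable[OF f(1) \<mu>]
      by (intro Bochner_Integration.integral_sum[symmetric]) (simp add: set_integrable_def)
    also have "\<dots> \<le> C * \<tau>"
      using set_integral_abs_le_interval[OF orbit_measurable[OF SJ(1) \<mu>] orbit_abs_le[OF SJ(1,2) \<mu>], of 0 \<tau>] \<tau>
      by (simp add: abs_le_iff)
    finally show ?thesis by simp
  qed
  \<comment> \<open>With \<open>\<tau> > K\<close>, the lower bound \<open>(C + 1) * \<tau>\<close>
    exceeds \<open>C * \<tau> + K\<close>.\<close>
  define \<tau> where "\<tau> = max T (K + 1)"
  have \<tau>: "T \<le> \<tau>" "K < \<tau>" "0 < \<tau>" using c(2) by (auto simp: \<tau>_def)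
  have "C + 1 \<le> real M * (e * c)" using M c(1) \<open>0 < e\<close> by (simp add: field_simps)
  from mult_right_mono[OF this, of \<tau>] \<tau>(3) have "(C + 1) * \<tau> \<le> real M * e * (c * \<tau>)" by (simp add: ac_simps)
  with main[OF \<tau>(1)] \<tau>(2) show False by (simp add: algebra_simps)
qed

text \<open>Gliding hump: points \<open>y k\<close> tending to \<open>z\<close> and indices \<open>n k\<close> are chosen so that the sum \<open>S\<close> of the
  increments of \<open>\<phi>\<close> at the \<open>n k\<close> separates \<open>y k\<close> from \<open>z\<close> at time \<open>t (n k)\<close>. Any such partial sum of
  the telescoping series is continuous, since its tails are dominated by \<open>\<phi>\<close>.\<close>
lemma no_hump:
  fixes \<phi> :: "nat \<Rightarrow> 'a \<Rightarrow> real"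
  assumes \<phi>: "\<And>n. \<phi> n \<in> Cb" "\<And>x. decseq (\<lambda>n. \<phi> n x)" "\<And>x. (\<lambda>n. \<phi> n x) \<longlonglongrightarrow> 0"
    and t: "\<And>n. 0 \<le> t n" and e: "0 < e"
    and hump: "\<And>n. 4 * e \<le> P (t n) (\<lambda>x. \<phi> n x - \<phi> (Suc n) x) z"
  shows False
proof -
  define f where "f n x = \<phi> n x - \<phi> (Suc n) x" for n x
  have f: "f n \<in> Cb" for n unfolding f_def by (intro Cb_intros \<phi>)
  have \<phi>_mono: "m \<le> n \<Longrightarrow> \<phi> n x \<le> \<phi> m x" for m n x using \<phi>(2) by (simp add: decseq_def)
  have \<phi>0: "0 \<le> \<phi> n x" for n x by (rule decseq_ge[OF \<phi>(2,3)])
  have f0: "0 \<le> f n x" for n x using \<phi>_mono[of n "Suc n"] by (simp add: f_def)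
  obtain C where C: "\<And>x. \<bar>\<phi> 0 x\<bar> \<le> C" using Cb_bounded[OF \<phi>(1)] by blast
  have \<phi>C: "\<bar>\<phi> n x\<bar> \<le> C" for n x using \<phi>_mono[of 0 n x] \<phi>0[of n x] C[of x] by simp
  have sumf: "(\<Sum>n\<in>I. f n x) \<le> C" if I: "finite I" for I x
  proof -
    obtain N where "I \<subseteq> {..<N}" using finite_nat_iff_bounded I by blast
    then have "(\<Sum>n\<in>I. f n x) \<le> (\<Sum>n<N. f n x)" by (intro sum_mono2) (auto simp: f0)
    also have "\<dots> = \<phi> 0 x - \<phi> N x" unfolding f_def by (rule sum_lessThan_telescope')
    also have "\<dots> \<le> C" using C[of x] \<phi>0[of N x] by simp
    finally show ?thesis .
  qed
  \<comment> \<open>A state holds the current point \<open>y\<close>, the current index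
    \<open>n\<close> and the sum \<open>h\<close> of the increments chosen earlier, excluding
    \<open>f n\<close>.\<close>
  let ?ok = "\<lambda>k (y, n, h). h \<in> Cb \<and> dist y z < 1 / real (Suc k) \<and> P (t n) (f n) y < e
    \<and> \<bar>P (t n) h y - P (t n) h z\<bar> < e"
  \<comment> \<open>The next index is so late that \<open>\<phi> n'\<close>, which dominates all
    later increments together, contributes less than \<open>e\<close> at \<open>y\<close>.\<close>
  let ?next = "\<lambda>(y, n, h) (y', n', h'). n < n' \<and> h' = (\<lambda>x. h x + f n x) \<and> P (t n) (\<phi> n') y < e"
  \<comment> \<open>Equicontinuity for the partial sum \<open>h\<close> fixes a ball around
    \<open>z\<close>; \<open>exists_small_value\<close> then finds \<open>y\<close> in it with an
    index beyond \<open>N\<close>.\<close>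
  have step: "\<exists>y n. N \<le> n \<and> ?ok k (y, n, h)" if h: "h \<in> Cb" for h k N
  proof -
    obtain d where d: "0 < d" "\<And>y t. dist y z < d \<Longrightarrow> 0 \<le> t \<Longrightarrow> \<bar>P t h y - P t h z\<bar> < e"
      using equicontinuous_atD[OF equicontinuous[OF h] h e] by blast
    obtain y n where "dist y z < min d (1 / real (Suc k))" "N \<le> n" "P (t n) (f n) y < e"
      using exists_small_value[where f=f and t=t and N=N, OF f f0 sumf t e, of "min d (1 / real (Suc k))"] d(1)
      by (auto simp del: of_nat_Suc)
    with h d(2)[of y "t n"] t[of n] show ?thesis
      by (intro exI[of _ y] exI[of _ n]) (simp del: of_nat_Suc)
  qed
  have "\<exists>X. \<forall>k. ?ok k (X k) \<and> ?next (X k) (X (Suc k))"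
  proof (rule dependent_nat_choice)
    show "\<exists>x. ?ok 0 x" proof -
      obtain y n where "?ok 0 (y, n, \<lambda>x. 0)" using step[OF Cb_const, of 0 0 0] by blast
      then show ?thesis by (rule exI)
    qed
    fix x k assume ok: "?ok k x"
    obtain y n h where x: "x = (y, n, h)" by (cases x) auto
    have "(\<lambda>m. P (t n) (\<phi> m) y) \<longlonglongrightarrow> 0" by (rule P_tendsto_0[OF t \<phi>(1) \<phi>C \<phi>(3)])
    from order_tendstoD(2)[OF this e] obtain N where N: "\<And>m. N \<le> m \<Longrightarrow> P (t n) (\<phi> m) y < e"
      by (auto simp: eventually_sequentially)
    have "(\<lambda>x. h x + f n x) \<in> Cb" using ok f by (auto simp: x intro: Cb_add)
    from step[OF this, of "max N (Suc n)" "Suc k"] obtain y' n' where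
      "max N (Suc n) \<le> n'" "?ok (Suc k) (y', n', (\<lambda>x. h x + f n x))" by blast
    with N show "\<exists>x'. ?ok (Suc k) x' \<and> ?next x x'"
      unfolding x by (intro exI[of _ "(y', n', (\<lambda>x. h x + f n x))"]) auto
  qed
  then obtain X where "\<forall>k. ?ok k (X k) \<and> ?next (X k) (X (Suc k))" by (rule exE)
  then have X: "?ok k (X k)" "?next (X k) (X (Suc k))" for k by simp_all
  define y n H where "y k = fst (X k)" and "n k = fst (snd (X k))" and "H k = snd (snd (X k))" for k
  have X_eq: "X k = (y k, n k, H k)" for k by (simp add: y_def n_def H_def)
  have ok: "H k \<in> Cb" "dist (y k) z < 1 / real (Suc k)" "P (t (n k)) (f (n k)) (y k) < e"
    "\<bar>P (t (n k)) (H k) (y k) - P (t (n k)) (H k) z\<bar> < e" for k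
    using X(1)[of k] by (simp_all add: X_eq)
  have nxt: "n k < n (Suc k)" "H (Suc k) = (\<lambda>x. H k x + f (n k) x)" "P (t (n k)) (\<phi> (n (Suc k))) (y k) < e" for k
    using X(2)[of k] by (simp_all add: X_eq)
  \<comment> \<open>The chosen increments telescope up to the nonnegative increments that are
    skipped.\<close>
  have H_le: "H l x - H k x \<le> \<phi> (n k) x - \<phi> (n l) x" if "k \<le> l" for k l x
    using that
  proof (induction l rule: dec_induct)
    case (step l)
    have "\<phi> (n (Suc l)) x \<le> \<phi> (Suc (n l)) x" using nxt(1)[of l] by (intro \<phi>_mono) simp
    with step.IH show ?case by (simp add: nxt(2) f_def)
  qed simp
  have H_inc: "incseq (\<lambda>k. H k x)" for x by (intro incseq_SucI) (simp add: nxt(2) f0)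
  have "\<exists>s. (\<lambda>k. H k x) \<longlonglongrightarrow> s" for x
  proof -
    have "H k x \<le> H 0 x + C" for k
      using H_le[of 0 k x] \<phi>0[of "n k" x] \<phi>C[of "n 0" x] by simp
    then show ?thesis using incseq_convergent[OF H_inc] by metis
  qed
  then obtain S where S: "\<And>x. (\<lambda>k. H k x) \<longlonglongrightarrow> S x" by metis
  have HS: "H k x \<le> S x" for k x using incseq_le[OF H_inc S] .
  have SH: "S x \<le> H k x + \<phi> (n k) x" for k x
  proof (rule LIMSEQ_le_const2[OF S], intro exI allI impI)
    fix l assume "k \<le> l"
    then show "H l x \<le> H k x + \<phi> (n k) x" using H_le[of k l x] \<phi>0[of "n l" x] by simp
  qed
  have n: "strict_mono n" using nxt(1) by (simp add: strict_mono_Suc_iff)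
  obtain D where D: "\<And>x. \<bar>H 0 x\<bar> \<le> D" using Cb_bounded[OF ok(1)] by blast
  have S_Cb: "S \<in> Cb"
  proof (rule CbI)
    show "continuous_on UNIV S"
      by (rule continuous_on_sandwich[OF Cb_continuous[OF ok(1)] Cb_continuous[OF \<phi>(1)] HS SH])
         (use LIMSEQ_subseq_LIMSEQ[OF \<phi>(3) n] in \<open>simp add: comp_def\<close>)
    show "\<bar>S x\<bar> \<le> D + C" for x
      using HS[of 0 x] SH[of x 0] D[of x] \<phi>C[of "n 0" x] by (simp add: abs_le_iff)
  qed
  obtain d where d: "0 < d" "\<And>y t. dist y z < d \<Longrightarrow> 0 \<le> t \<Longrightarrow> \<bar>P t S y - P t S z\<bar> < e"
    using equicontinuous_atD[OF equicontinuous[OF S_Cb] S_Cb e] by blast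
  obtain k where k: "1 / real (Suc k) < d" using nat_approx_posE[OF d(1)] by blast
  let ?P = "P (t (n k))"
  \<comment> \<open>At \<open>z\<close> the sum \<open>S\<close> gains at least \<open>4 * e\<close>
    over \<open>H k\<close>; at \<open>y k\<close> it gains less than \<open>2 * e\<close>, from
    \<open>f (n k)\<close> and the tail. As \<open>H k\<close> varies by less than \<open>e\<close>,
    a gap above \<open>e\<close> remains, against the choice of \<open>d\<close>.\<close>
  have "?P (H (Suc k)) z \<le> ?P S z" by (intro P_mono t ok S_Cb HS)
  moreover have "?P (H (Suc k)) z = ?P (H k) z + ?P (f (n k)) z" unfolding nxt(2) by (intro P_add t ok f)
  moreover have "4 * e \<le> ?P (f (n k)) z" using hump[of "n k"] by (simp add: f_def[abs_def])
  moreover have "?P S (y k) \<le> ?P (\<lambda>x. H (Suc k) x + \<phi> (n (Suc k)) x) (y k)"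
    by (intro P_mono t S_Cb Cb_intros ok \<phi> SH)
  moreover have "\<dots> = ?P (H (Suc k)) (y k) + ?P (\<phi> (n (Suc k))) (y k)" by (intro P_add t ok \<phi>)
  moreover have "?P (H (Suc k)) (y k) = ?P (H k) (y k) + ?P (f (n k)) (y k)" unfolding nxt(2) by (intro P_add t ok f)
  moreover have "\<bar>?P S (y k) - ?P S z\<bar> < e" using ok(2)[of k] k t by (intro d(2)) auto
  ultimately show False using ok(3,4)[of k] nxt(3)[of k] by (simp add: abs_less_iff)
qed

text \<open>If the claim fails, monotonicity in \<open>n\<close> gives for each \<open>n\<close> a
  time at which \<open>\<phi> n\<close> has value at least \<open>e\<close> at \<open>z\<close>.
  Thinning the sequence turns these values into humps of its increments, which
  \<open>no_hump\<close> excludes.\<close>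

lemma uniformly_small:
  fixes \<phi> :: "nat \<Rightarrow> 'a \<Rightarrow> real"
  assumes \<phi>: "\<And>n. \<phi> n \<in> Cb" "\<And>x. decseq (\<lambda>n. \<phi> n x)" "\<And>x. (\<lambda>n. \<phi> n x) \<longlonglongrightarrow> 0"
    and e: "0 < e"
  obtains N where "\<And>n t. N \<le> n \<Longrightarrow> 0 \<le> t \<Longrightarrow> P t (\<phi> n) z < e"
proof (rule ccontr)
  assume neg: "\<not> thesis"
  have \<phi>_mono: "m \<le> n \<Longrightarrow> \<phi> n x \<le> \<phi> m x" for m n x using \<phi>(2) by (simp add: decseq_def)
  have \<phi>0: "0 \<le> \<phi> n x" for n x by (rule decseq_ge[OF \<phi>(2,3)])
  obtain C where C: "\<And>x. \<bar>\<phi> 0 x\<bar> \<le> C" using Cb_bounded[OF \<phi>(1)] by blast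
  have \<phi>C: "\<bar>\<phi> n x\<bar> \<le> C" for n x using \<phi>_mono[of 0 n x] \<phi>0[of n x] C[of x] by simp
  have "\<exists>t\<ge>0. e \<le> P t (\<phi> n) z" for n
  proof (rule ccontr)
    assume n: "\<not> (\<exists>t\<ge>0. e \<le> P t (\<phi> n) z)"
    have "P t (\<phi> m) z < e" if "n \<le> m" "0 \<le> t" for m t
      using P_mono[OF that(2) \<phi>(1) \<phi>(1) \<phi>_mono[OF that(1)], of z] n that(2) by force
    with neg that show False by blast
  qed
  then obtain \<tau> where \<tau>: "\<And>n. 0 \<le> \<tau> n" "\<And>n. e \<le> P (\<tau> n) (\<phi> n) z" by metis
  \<comment> \<open>The next function is chosen below \<open>e / 2\<close> at the current time, so
    the increment keeps at least \<open>e / 2\<close>, which is \<open>4 * (e / 8)\<close>.\<close>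
  have "\<exists>r. \<forall>k. True \<and> r k < r (Suc k) \<and> P (\<tau> (r k)) (\<phi> (r (Suc k))) z < e / 2"
  proof (rule dependent_nat_choice)
    fix n :: nat
    have "(\<lambda>m. P (\<tau> n) (\<phi> m) z) \<longlonglongrightarrow> 0" by (rule P_tendsto_0[OF \<tau>(1) \<phi>(1) \<phi>C \<phi>(3)])
    from order_tendstoD(2)[OF this half_gt_zero[OF e]] obtain N where
      "\<And>m. N \<le> m \<Longrightarrow> P (\<tau> n) (\<phi> m) z < e / 2"
      by (auto simp: eventually_sequentially)
    then show "\<exists>m. True \<and> n < m \<and> P (\<tau> n) (\<phi> m) z < e / 2"
      by (intro exI[of _ "max N (Suc n)"]) auto
  qed simp
  then obtain r where r: "\<And>k. r k < r (Suc k)" "\<And>k. P (\<tau> (r k)) (\<phi> (r (Suc k))) z < e / 2" by blast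
  have mono: "strict_mono r" using r(1) by (simp add: strict_mono_Suc_iff)
  show False
  proof (rule no_hump[where \<phi>="\<lambda>k. \<phi> (r k)" and t="\<lambda>k. \<tau> (r k)" and e="e / 8"])
    show "decseq (\<lambda>k. \<phi> (r k) x)" for x
      using mono \<phi>_mono by (simp add: decseq_def strict_mono_less_eq)
    show "(\<lambda>k. \<phi> (r k) x) \<longlonglongrightarrow> 0" for x
      using LIMSEQ_subseq_LIMSEQ[OF \<phi>(3) mono] by (simp add: comp_def)
    show "4 * (e / 8) \<le> P (\<tau> (r k)) (\<lambda>x. \<phi> (r k) x - \<phi> (r (Suc k)) x) z" for k
      using \<tau>(2)[of "r k"] r(2)[of k] by (simp add: P_diff \<tau>(1) \<phi>(1))
  qed (use \<phi> \<tau> e in auto)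
qed

section \<open>Krylov-Bogoliubov averages and the invariant measure\<close>

lemma invariant_probability_exists: "\<exists>\<mu>'. invariant_probability Pd \<mu>'"
proof -
  let ?\<delta> = "return borel z"
  \<comment> \<open>The averages start from the point mass at \<open>z\<close>, where
    \<open>uniformly_small\<close> gives control. The value 0 outside \<open>Cb\<close> keeps every
    coordinate bounded, and \<open>Suc n\<close> avoids an empty averaging window.\<close>
  define a where "a n f = (if f \<in> Cb then 1 / real (Suc n) * (LBINT s:{0..real (Suc n)}. orbit ?\<delta> f s) else 0)"
    for n :: nat and f
  have a_le: "a n f \<le> B" if "f \<in> Cb" "\<And>s. 0 \<le> s \<Longrightarrow> orbit ?\<delta> f s \<le> B" for n f B
  proof -
    have "(LBINT s:{0..real (Suc n)}. orbit ?\<delta> f s) \<le> (LBINT s:{0..real (Suc n)}. B)"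
      using that by (intro set_integral_mono orbit_integrable return_M1
          set_integrable_bounded_interval[where C="\<bar>B\<bar>"]) auto
    then show ?thesis using that(1) by (simp add: a_def set_integral_const field_simps del: of_nat_Suc)
  qed
  have a_scale: "a n (\<lambda>x. c * f x) = c * a n f" if "f \<in> Cb" for n c f
    using that by (simp add: a_def orbit_scale[abs_def] Cb_mult)
  have a_add: "a n (\<lambda>x. f x + g x) = a n f + a n g" if "f \<in> Cb" "g \<in> Cb" for n f g
  proof -
    have "orbit ?\<delta> (\<lambda>x. f x + g x) = (\<lambda>s. orbit ?\<delta> f s + orbit ?\<delta> g s)"
      by (intro ext orbit_add that return_M1)
    then show ?thesis
      using that orbit_integrable[OF _ return_M1]
      by (simp add: a_def Cb_add set_integral_add distrib_left)
  qed
  have a_nonneg: "0 \<le> a n f" if "f \<in> Cb" "\<And>x. 0 \<le> f x" for n f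
  proof -
    have "orbit ?\<delta> (\<lambda>x. - 1 * f x) s \<le> 0" for s
    proof -
      have "orbit ?\<delta> (\<lambda>x. 0) s \<le> orbit ?\<delta> f s" by (intro orbit_mono that return_M1 Cb_const)
      then show ?thesis unfolding orbit_scale by (simp add: orbit_def)
    qed
    then have "a n (\<lambda>x. - 1 * f x) \<le> 0" by (intro a_le Cb_intros that)
    with a_scale[OF that(1), of n "- 1"] show ?thesis by simp
  qed
  have a_one: "a n (\<lambda>x. 1) = 1" for n
    by (simp add: a_def orbit_def[abs_def] Pd_M1 return_M1 set_integral_const del: of_nat_Suc)
  have a_abs: "\<bar>a n f\<bar> \<le> C" if f: "f \<in> Cb" and C: "\<And>x. \<bar>f x\<bar> \<le> C" for n f C
  proof -
    have o: "\<bar>orbit ?\<delta> f s\<bar> \<le> C" for s using orbit_abs_le[OF f C return_M1] .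
    have "a n f \<le> C" using o by (intro a_le f) (simp add: abs_le_iff)
    moreover have "a n (\<lambda>x. - 1 * f x) \<le> C"
    proof (rule a_le)
      show "orbit ?\<delta> (\<lambda>x. - 1 * f x) s \<le> C" for s
        using o[of s] unfolding orbit_scale by (simp add: abs_le_iff)
    qed (intro Cb_intros f)
    ultimately show ?thesis using a_scale[OF f, of n "- 1"] by (simp add: abs_le_iff)
  qed
  \<comment> \<open>Applying \<open>P r\<close> shifts the averaging window by \<open>r\<close>,
    which costs at most \<open>2 * C * r / Suc n\<close>.\<close>
  have a_inv: "(\<lambda>n. a n (P r f) - a n f) \<longlonglongrightarrow> 0" if f: "f \<in> Cb" and r: "0 \<le> r" for f r
  proof -
    obtain C where C: "\<And>x. \<bar>f x\<bar> \<le> C" using f Cb_bounded by blast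
    have "\<bar>a n (P r f) - a n f\<bar> \<le> 2 * C * r * inverse (real (Suc n))" for n
    proof -
      let ?n = "real (Suc n)"
      have "(LBINT s:{0..?n}. orbit ?\<delta> (P r f) s) = (LBINT s:{0..?n}. orbit ?\<delta> f (s + r))"
        using f r by (intro set_lebesgue_integral_cong) (auto simp: orbit_shift return_M1)
      moreover have "\<bar>(LBINT s:{0..?n}. orbit ?\<delta> f (s + r)) - (LBINT s:{0..?n}. orbit ?\<delta> f s)\<bar> \<le> 2 * C * r"
        using r f C by (intro set_integral_shift_le orbit_measurable orbit_abs_le return_M1) auto
      ultimately have "\<bar>?n * a n (P r f) - ?n * a n f\<bar> \<le> 2 * C * r"
        using f P_Cb[OF r f] by (simp add: a_def del: of_nat_Suc)
      then have "?n * \<bar>a n (P r f) - a n f\<bar> \<le> 2 * C * r"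
        by (simp add: right_diff_distrib[symmetric] abs_mult del: of_nat_Suc)
      then show ?thesis by (simp add: field_simps del: of_nat_Suc)
    qed
    then have "\<forall>\<^sub>F n in sequentially. norm (a n (P r f) - a n f) \<le> 2 * C * r * inverse (real (Suc n))"
      unfolding real_norm_def by (intro always_eventually allI)
    moreover have "(\<lambda>n. 2 * C * r * inverse (real (Suc n))) \<longlonglongrightarrow> 0"
      using tendsto_mult[OF tendsto_const LIMSEQ_inverse_real_of_nat, of "2 * C * r"] by simp
    ultimately show ?thesis by (rule Lim_null_comparison)
  qed
  have "bounded (range (\<lambda>n. a n f))" for f
  proof (cases "f \<in> Cb")
    case True
    then obtain C where "\<And>x. \<bar>f x\<bar> \<le> C" using Cb_bounded by blast
    with a_abs[OF True] show ?thesis by (auto intro!: boundedI[where B=C])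
  qed (simp add: a_def)
  then obtain F L where F: "F \<noteq> bot" "F \<le> sequentially" and L: "\<And>f. ((\<lambda>n. a n f) \<longlongrightarrow> L f) F"
    using bounded_family_cluster by blast
  note uniq = tendsto_unique[OF F(1)]
  interpret L: daniell_functional L
  proof
    show "L (\<lambda>x. f x + g x) = L f + L g" if "f \<in> Cb" "g \<in> Cb" for f g
      using L[of "\<lambda>x. f x + g x"] tendsto_add[OF L L] unfolding a_add[OF that] by (rule uniq)
    show "L (\<lambda>x. c * f x) = c * L f" if "f \<in> Cb" for c f
      using L[of "\<lambda>x. c * f x"] tendsto_mult[OF tendsto_const L] unfolding a_scale[OF that] by (rule uniq)
    show "0 \<le> L f" if "f \<in> Cb" "\<And>x. 0 \<le> f x" for f
      by (rule tendsto_lowerbound[OF L _ F(1)]) (simp add: a_nonneg[OF that])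
    show "L (\<lambda>x. 1) = 1" using L[of "\<lambda>x. 1"] tendsto_const unfolding a_one by (rule uniq)
    fix \<phi> :: "nat \<Rightarrow> 'a \<Rightarrow> real"
    assume \<phi>: "\<And>n. \<phi> n \<in> Cb" "\<And>x. decseq (\<lambda>n. \<phi> n x)" "\<And>x. (\<lambda>n. \<phi> n x) \<longlonglongrightarrow> 0"
    show "(\<lambda>n. L (\<phi> n)) \<longlonglongrightarrow> 0"
    proof (rule LIMSEQ_I)
      fix e :: real assume "0 < e"
      then obtain N where N: "\<And>n t. N \<le> n \<Longrightarrow> 0 \<le> t \<Longrightarrow> P t (\<phi> n) z < e / 2"
        using uniformly_small[OF \<phi>, of "e / 2"] by auto
      have "norm (L (\<phi> n) - 0) < e" if "N \<le> n" for n
      proof -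
        \<comment> \<open>The bound is uniform over the averaging lengths, so it survives the limit
          along \<open>F\<close>; halving \<open>e\<close> keeps the final inequality
          strict.\<close>
        have "a k (\<phi> n) \<le> e / 2" for k
          using N[OF that] \<phi>(1) by (intro a_le) (auto simp: orbit_return less_imp_le)
        then have "L (\<phi> n) \<le> e / 2" by (intro tendsto_upperbound[OF L _ F(1)]) simp
        moreover have "0 \<le> L (\<phi> n)"
          by (rule tendsto_lowerbound[OF L _ F(1)]) (simp add: a_nonneg[OF \<phi>(1) decseq_ge[OF \<phi>(2,3)]])
        ultimately show ?thesis using \<open>0 < e\<close> by simp
      qed
      then show "\<exists>N. \<forall>n\<ge>N. norm (L (\<phi> n) - 0) < e" by blast
    qed
  qed
  have L_inv: "L (P r f) = L f" if "f \<in> Cb" "0 \<le> r" for f r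
    using uniq[OF tendsto_diff[OF L L] tendsto_mono[OF F(2) a_inv[OF that]]] by simp
  obtain m where m: "m \<in> M1" "\<And>f. f \<in> Cb \<Longrightarrow> (\<integral>x. f x \<partial>m) = L f"
    using L.representation by blast
  \<comment> \<open>Both measures have the same integrals over \<open>Cb\<close>, by duality and the
    invariance of \<open>L\<close>.\<close>
  have "Pd r m = m" if "0 \<le> r" for r
    by (rule M1_eqI) (use that m in \<open>auto simp: Pd_M1 integral_Pd Cb_subset_Bb P_Cb L_inv\<close>)
  with m(1) show ?thesis by (auto simp: invariant_probability_def)
qed

end

theorem theorem3p6:
  fixes P :: "real \<Rightarrow> ('a::metric_space \<Rightarrow> real) \<Rightarrow> ('a \<Rightarrow> real)"
    and Pd :: "real \<Rightarrow> 'a measure \<Rightarrow> 'a measure"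
    and z :: 'a and \<mu> :: "'a measure"
  assumes "markov_semigroup P"
    and "feller P"
    and "stochastically_continuous P"
    and "dual_semigroup P Pd"
    and "\<mu> \<in> M1"
    and "\<And>\<epsilon>::real. \<epsilon> > 0 \<Longrightarrow>
      Liminf at_top (\<lambda>t::real. ereal (1 / t * (LBINT s:{0..t}. measure (Pd s \<mu>) (ball z \<epsilon>)))) > 0"
    and "\<And>\<phi>. \<phi> \<in> Cb \<Longrightarrow> equicontinuous_at P \<phi> z"
  shows "\<exists>\<mu>'. invariant_probability Pd \<mu>'"
proof -
  interpret feller_markov_lower_bound P Pd z \<mu>
    using assms by unfold_locales
  show ?thesis by (rule invariant_probability_exists)
qed

end
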